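(* Property $(N)$ is not hereditary; that is, there exist a real Banach space $Z$ with Property $(N)$ and a closed subspace $X\subset Z$ such that $X$ does not have Property $(N)$.
   Context: $B_Z$ and $S_Z$ denote the closed unit ball and unit sphere of a Banach space $Z$. A point $z_0^*\in B_{Z^*}$ is a Namioka point of $B_{Z^*}$ if the identity map $(B_{Z^*},\text{weak}^* )\to(B_{Z^*},\text{weak})$ is continuous at $z_0^*$, where the weak topology on $Z^*$ is the one induced by $Z^{**}$. A Banach space $Z$ has Property $(N)$ if the set of Namioka points of $B_{Z^*}$ is weakly dense in $S_{Z^*}$. *)

theory Defs
  imports "HOL-Analysis.Analysis" "HOL-Algebra.Module" "HOL-Algebra.Algebraic_Closure_Type"
begin

text \<open>
  The statement quantifies existentially over Banach spaces, so a Banach space has to be an object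
  rather than a type. It is a module over the real field, in the sense of \<open>HOL-Algebra\<close>, together
  with a norm. The fields \<open>mult\<close> and \<open>one\<close> that the record \<open>module\<close> inherits from \<open>ring\<close> are not
  constrained by the locale \<open>module\<close> and play no role.
\<close>

abbreviation real_field :: "real ring"
  where "real_field \<equiv> ring_of_type_algebra"

record 'a normed_structure = "(real, 'a) module" +
  nrm :: "'a \<Rightarrow> real"

locale real_normed_space = module real_field Z
  for Z :: "'a normed_structure" (structure) +
  assumes nrm_nonneg: "x \<in> carrier Z \<Longrightarrow> 0 \<le> nrm Z x"
    and nrm_eq_zero_iff: "x \<in> carrier Z \<Longrightarrow> nrm Z x = 0 \<longleftrightarrow> x = \<zero>"
    and nrm_smult: "x \<in> carrier Z \<Longrightarrow> nrm Z (c \<odot> x) = \<bar>c\<bar> * nrm Z x"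
    and nrm_triangle: "x \<in> carrier Z \<Longrightarrow> y \<in> carrier Z \<Longrightarrow> nrm Z (x \<oplus> y) \<le> nrm Z x + nrm Z y"

text \<open>
  The locale \<open>Metric_space\<close> demands symmetry and nonnegativity of the distance on the whole type,
  hence the value 0 outside the carrier.
\<close>

definition nrm_dist :: "'a normed_structure \<Rightarrow> 'a \<Rightarrow> 'a \<Rightarrow> real"
  where "nrm_dist Z x y =
    (if x \<in> carrier Z \<and> y \<in> carrier Z then nrm Z (x \<ominus>\<^bsub>Z\<^esub> y) else 0)"

definition real_banach_space :: "'a normed_structure \<Rightarrow> bool"
  where "real_banach_space Z \<longleftrightarrow>
    real_normed_space Z \<and> Metric_space.mcomplete (carrier Z) (nrm_dist Z)"

definition closed_subspace :: "'a set \<Rightarrow> 'a normed_structure \<Rightarrow> bool"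
  where "closed_subspace Y Z \<longleftrightarrow>
    submodule Y real_field Z \<and> closedin (Metric_space.mtopology (carrier Z) (nrm_dist Z)) Y"

definition closed_unit_ball :: "'a normed_structure \<Rightarrow> 'a set"
  where "closed_unit_ball Z = {x \<in> carrier Z. nrm Z x \<le> 1}"

definition unit_sphere :: "'a normed_structure \<Rightarrow> 'a set"
  where "unit_sphere Z = {x \<in> carrier Z. nrm Z x = 1}"

text \<open>
  Functionals are extended by 0 outside the carrier. This makes the representation unique and lets
  the operations of the dual be the pointwise ones.
\<close>

definition bounded_functionals :: "'a normed_structure \<Rightarrow> ('a \<Rightarrow> real) set"
  where "bounded_functionals Z =
    {f. (\<forall>x\<in>carrier Z. \<forall>y\<in>carrier Z. f (x \<oplus>\<^bsub>Z\<^esub> y) = f x + f y) \<and>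
        (\<forall>c. \<forall>x\<in>carrier Z. f (c \<odot>\<^bsub>Z\<^esub> x) = c * f x) \<and>
        (\<exists>B. \<forall>x\<in>carrier Z. \<bar>f x\<bar> \<le> B * nrm Z x) \<and>
        (\<forall>x. x \<notin> carrier Z \<longrightarrow> f x = 0)}"

definition dual_space :: "'a normed_structure \<Rightarrow> ('a \<Rightarrow> real) normed_structure"
  where "dual_space Z =
    \<lparr>carrier = bounded_functionals Z,
     monoid.mult = undefined,
     one = undefined,
     zero = (\<lambda>x. 0),
     add = (\<lambda>f g x. f x + g x),
     smult = (\<lambda>c f x. c * f x),
     nrm = (\<lambda>f. SUP x\<in>closed_unit_ball Z. \<bar>f x\<bar>)\<rparr>"

text \<open>The coarsest topology on \<open>V\<close> that makes all functions in \<open>\<Phi>\<close> continuous.\<close>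

definition initial_topology :: "'a set \<Rightarrow> ('a \<Rightarrow> real) set \<Rightarrow> 'a topology"
  where "initial_topology V \<Phi> =
    topology_generated_by {{x \<in> V. \<phi> x \<in> U} |\<phi> U. \<phi> \<in> \<Phi> \<and> open U}"

definition weak_topology :: "'a normed_structure \<Rightarrow> 'a topology"
  where "weak_topology Z = initial_topology (carrier Z) (carrier (dual_space Z))"

definition weak_star_topology :: "'a normed_structure \<Rightarrow> ('a \<Rightarrow> real) topology"
  where "weak_star_topology Z =
    initial_topology (carrier (dual_space Z)) ((\<lambda>x f. f x) ` carrier Z)"

definition namioka_point :: "'a normed_structure \<Rightarrow> ('a \<Rightarrow> real) \<Rightarrow> bool"
  where "namioka_point Z f \<longleftrightarrow>
    f \<in> closed_unit_ball (dual_space Z) \<and>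
    topcontinuous_at
      (subtopology (weak_star_topology Z) (closed_unit_ball (dual_space Z)))
      (subtopology (weak_topology (dual_space Z)) (closed_unit_ball (dual_space Z)))
      id f"

text \<open>
  Namioka points need not lie on the sphere (in a reflexive space every point of the dual ball is
  one), so density in the sphere means that the sphere is contained in the weak closure.
\<close>

definition property_N :: "'a normed_structure \<Rightarrow> bool"
  where "property_N Z \<longleftrightarrow>
    unit_sphere (dual_space Z) \<subseteq> weak_topology (dual_space Z) closure_of {f. namioka_point Z f}"

end

theory Submission
  imports Defs
begin

text \<open>
  The subspace is the space \<open>c\<close> of convergent sequences with the supremum norm. Its dual is the
  closed linear span of the coordinate functionals and the limit functional, and every functional \<open>f\<close> carries a mass at
  infinity, the limit of its values on the indicators of \<open>{n<..}\<close>. This mass can be moved to the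
  coordinate \<open>k\<close> without increasing the norm, and as \<open>k\<close> grows the modified functionals converge to
  \<open>f\<close> in the weak* sense. The mass at infinity is a bounded functional on the dual and vanishes on
  all modified functionals, so it vanishes at every Namioka point
  (\<open>mass_at_infinity_namioka_point\<close>). The limit functional lies on the dual sphere and has mass one,
  so the Namioka points are not weakly dense in that sphere.

  The large space consists of the pairs of a convergent sequence \<open>y\<close> and a real \<open>s\<close>, with the norm
  \<open>max (sup \<bar>y i\<bar>) (sqrt ((lim y)\<^sup>2 + s\<^sup>2))\<close>; the subspace is the hyperplane \<open>s = 0\<close>. The dual of
  this space is the \<open>\<ell>\<^sub>1\<close>-sum of \<open>\<ell>\<^sub>1\<close>, acting on the terms, and a Euclidean plane, acting on the pair
  \<open>(lim y, s)\<close>. If a functional does not vanish on the extra coordinate, its component in the Euclidean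
  plane is not parallel to the limit axis. Moving mass from infinity to a coordinate then costs strictly
  more in the \<open>\<ell>\<^sub>1\<close> part than it gains in the Euclidean part, and so it is impossible
  in the unit ball when the norm of the functional is one: weak* convergence to such a functional inside
  the ball is norm convergence. Hence all functionals of norm one that do not vanish on the extra
  coordinate are Namioka points (\<open>namioka_point_of_unit_sphere\<close>), and they are norm dense in the sphere
  (\<open>property_N_conv_space\<close>).

  For the large space this comparison of costs is carried out on vectors. A functional \<open>f\<close> of norm one that
  does not vanish on the extra coordinate is almost normed by vectors \<open>v\<close> of the unit ball whose limit stays away from \<open>1\<close> in
  absolute value. Such a \<open>v\<close> has slack in its tail: any small null sequence that lives far out can be
  added to or subtracted from it inside the ball. A functional of the dual ball that almost attains
  its norm at \<open>v\<close> is therefore small on all these tails (\<open>slack_controls_null_tail\<close>), and what remains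
  depends on finitely many vectors only, which the weak* topology controls.
\<close>

section \<open>Initial topologies\<close>

lemma openin_initial_topology_preimage:
  assumes "\<phi> \<in> \<Phi>" "open U"
  shows "openin (initial_topology V \<Phi>) {x \<in> V. \<phi> x \<in> U}"
  unfolding initial_topology_def using assms by (intro topology_generated_by_Basis) blast

lemma topspace_initial_topology:
  assumes "\<Phi> \<noteq> {}"
  shows "topspace (initial_topology V \<Phi>) = V"
proof -
  have "V \<in> {{x \<in> V. \<phi> x \<in> U} |\<phi> U. \<phi> \<in> \<Phi> \<and> open U}"
    using assms by (auto intro!: exI[of _ UNIV])
  then show ?thesis
    unfolding initial_topology_def topology_generated_by_topspace by blast
qed

text \<open>
  Convergence against every function in \<open>\<Phi>\<close> is convergence in the initial topology. Stating it along an
  arbitrary filter covers both weak* convergent sequences and the neighbourhoods of a point in norm.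
\<close>

lemma eventually_in_initial_topology_open:
  assumes W: "openin (initial_topology V \<Phi>) W" "x \<in> W"
    and lim: "\<And>\<phi>. \<phi> \<in> \<Phi> \<Longrightarrow> ((\<lambda>i. \<phi> (y i)) \<longlongrightarrow> \<phi> x) F"
    and V: "eventually (\<lambda>i. y i \<in> V) F"
  shows "eventually (\<lambda>i. y i \<in> W) F"
proof -
  have "generate_topology_on {{x \<in> V. \<phi> x \<in> U} |\<phi> U. \<phi> \<in> \<Phi> \<and> open U} W"
    using W(1) unfolding initial_topology_def openin_topology_generated_by_iff .
  then show ?thesis
    using W(2)
  proof induction
    case Empty
    then show ?case by simp
  next
    case (Int a b)
    then show ?case by (auto intro: eventually_conj)
  next
    case (UN K)
    then obtain k where "k \<in> K" "eventually (\<lambda>i. y i \<in> k) F" by blast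
    then show ?case by (auto elim!: eventually_mono)
  next
    case (Basis s)
    then obtain \<phi> U where s: "s = {x \<in> V. \<phi> x \<in> U}" "\<phi> \<in> \<Phi>" "open U" by blast
    with Basis have "eventually (\<lambda>i. \<phi> (y i) \<in> U) F"
      using lim topological_tendstoD by blast
    with V show ?case
      unfolding s(1) by eventually_elim simp
  qed
qed

section \<open>Dual norm and weak topologies\<close>

lemma dual_space_sel [simp]:
  "carrier (dual_space Z) = bounded_functionals Z"
  "\<zero>\<^bsub>dual_space Z\<^esub> = (\<lambda>x. 0)"
  "f \<oplus>\<^bsub>dual_space Z\<^esub> g = (\<lambda>x. f x + g x)"
  "c \<odot>\<^bsub>dual_space Z\<^esub> f = (\<lambda>x. c * f x)"
  by (simp_all add: dual_space_def)

lemma nrm_dual_space: "nrm (dual_space Z) f = (SUP x\<in>closed_unit_ball Z. \<bar>f x\<bar>)"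
  by (simp add: dual_space_def)

lemma bounded_functionals_add:
  assumes "f \<in> bounded_functionals Z" "g \<in> bounded_functionals Z"
  shows "(\<lambda>x. f x + g x) \<in> bounded_functionals Z"
proof -
  obtain B C where "\<forall>x\<in>carrier Z. \<bar>f x\<bar> \<le> B * nrm Z x" "\<forall>x\<in>carrier Z. \<bar>g x\<bar> \<le> C * nrm Z x"
    using assms unfolding bounded_functionals_def by blast
  then have "\<forall>x\<in>carrier Z. \<bar>f x + g x\<bar> \<le> (B + C) * nrm Z x"
    by (fastforce simp: distrib_right)
  then show ?thesis
    using assms unfolding bounded_functionals_def by (auto simp: distrib_left)
qed

lemma bounded_functionals_scale:
  assumes "f \<in> bounded_functionals Z"
  shows "(\<lambda>x. c * f x) \<in> bounded_functionals Z"
proof -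
  obtain B where B: "\<forall>x\<in>carrier Z. \<bar>f x\<bar> \<le> B * nrm Z x"
    using assms unfolding bounded_functionals_def by blast
  have "\<forall>x\<in>carrier Z. \<bar>c * f x\<bar> \<le> (\<bar>c\<bar> * B) * nrm Z x"
    using B by (auto simp: abs_mult mult.assoc intro!: mult_left_mono)
  then show ?thesis
    using assms unfolding bounded_functionals_def by (auto simp: distrib_left)
qed

lemma bounded_functionals_diff:
  assumes "f \<in> bounded_functionals Z" "g \<in> bounded_functionals Z"
  shows "(\<lambda>x. f x - g x) \<in> bounded_functionals Z"
  using bounded_functionals_add[OF assms(1) bounded_functionals_scale[OF assms(2), of "-1"]] by simp

lemma bounded_functionalsD:
  assumes "f \<in> bounded_functionals Z"
  shows "\<lbrakk>x \<in> carrier Z; y \<in> carrier Z\<rbrakk> \<Longrightarrow> f (x \<oplus>\<^bsub>Z\<^esub> y) = f x + f y"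
    and "x \<in> carrier Z \<Longrightarrow> f (c \<odot>\<^bsub>Z\<^esub> x) = c * f x"
    and "\<exists>B. \<forall>x\<in>carrier Z. \<bar>f x\<bar> \<le> B * nrm Z x"
    and "x \<notin> carrier Z \<Longrightarrow> f x = 0"
  using assms unfolding bounded_functionals_def by auto

lemma zero_bounded_functional: "(\<lambda>x. 0) \<in> bounded_functionals Z"
  unfolding bounded_functionals_def by (auto intro: exI[of _ 0])

context real_normed_space
begin

lemma nrm_zero: "nrm Z \<zero> = 0"
  using nrm_eq_zero_iff by auto

lemma dual_norm_le:
  assumes "\<And>x. x \<in> closed_unit_ball Z \<Longrightarrow> \<bar>f x\<bar> \<le> C"
  shows "nrm (dual_space Z) f \<le> C"
  unfolding nrm_dual_space
proof (rule cSUP_least)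
  show "closed_unit_ball Z \<noteq> {}"
    unfolding closed_unit_ball_def using nrm_zero by (auto intro!: exI[of _ \<zero>])
qed (rule assms)

lemma abs_le_dual_norm:
  assumes f: "f \<in> bounded_functionals Z" and x: "x \<in> carrier Z"
  shows "\<bar>f x\<bar> \<le> nrm (dual_space Z) f * nrm Z x"
proof -
  obtain B where B: "\<And>x. x \<in> carrier Z \<Longrightarrow> \<bar>f x\<bar> \<le> B * nrm Z x"
    using bounded_functionalsD(3)[OF f] by blast
  show ?thesis
  proof (cases "nrm Z x = 0")
    case True
    then show ?thesis using B[OF x] by simp
  next
    case False
    then have pos: "0 < nrm Z x" using nrm_nonneg[OF x] by simp
    define y where "y = (1 / nrm Z x) \<odot> x"
    have c: "c \<odot> z \<in> carrier Z" if "z \<in> carrier Z" for c z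
      using that smult_closed by (simp add: ring_of_type_algebra_def)
    have y: "y \<in> carrier Z" "nrm Z y = 1"
      using c[OF x] pos nrm_smult[OF x] by (simp_all add: y_def)
    have "bdd_above ((\<lambda>x. \<bar>f x\<bar>) ` closed_unit_ball Z)"
    proof (rule bdd_aboveI2)
      fix z assume z: "z \<in> closed_unit_ball Z"
      then have "\<bar>f z\<bar> \<le> B * nrm Z z" using B by (simp add: closed_unit_ball_def)
      also have "\<dots> \<le> \<bar>B\<bar> * 1"
        using z nrm_nonneg by (intro mult_mono) (auto simp: closed_unit_ball_def)
      finally show "\<bar>f z\<bar> \<le> \<bar>B\<bar>" by simp
    qed
    then have "\<bar>f y\<bar> \<le> nrm (dual_space Z) f"
      unfolding nrm_dual_space using y by (intro cSUP_upper) (auto simp: closed_unit_ball_def)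
    moreover have "f y = f x / nrm Z x"
      using bounded_functionalsD(2)[OF f x] by (simp add: y_def)
    ultimately show ?thesis using pos by (simp add: field_simps abs_div)
  qed
qed

lemma dual_norm_nonneg:
  assumes "f \<in> bounded_functionals Z"
  shows "0 \<le> nrm (dual_space Z) f"
proof (rule ccontr)
  assume neg: "\<not> ?thesis"
  have "\<bar>f x\<bar> \<le> 0" if "x \<in> carrier Z" for x
  proof -
    have "nrm (dual_space Z) f * nrm Z x \<le> 0"
      using neg nrm_nonneg[OF that] by (simp add: mult_nonpos_nonneg)
    then show ?thesis using abs_le_dual_norm[OF assms that] by simp
  qed
  then have z: "f x = 0" for x
    using bounded_functionalsD(4)[OF assms] by (cases "x \<in> carrier Z") auto
  have "nrm (dual_space Z) f = (SUP x\<in>closed_unit_ball Z. 0)"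
    unfolding nrm_dual_space by (simp add: z)
  also have "closed_unit_ball Z \<noteq> {}"
    unfolding closed_unit_ball_def using nrm_zero by (auto intro!: exI[of _ \<zero>])
  then have "(SUP x\<in>closed_unit_ball Z. 0) = (0::real)" by simp
  finally show False using neg by simp
qed

lemma abs_le_dual_norm_ball:
  assumes f: "f \<in> bounded_functionals Z" and x: "x \<in> closed_unit_ball Z"
  shows "\<bar>f x\<bar> \<le> nrm (dual_space Z) f"
proof -
  have "x \<in> carrier Z" "nrm Z x \<le> 1" using x by (auto simp: closed_unit_ball_def)
  then show ?thesis
    using abs_le_dual_norm[OF f, of x] mult_left_mono[of "nrm Z x" 1 "nrm (dual_space Z) f"]
      dual_norm_nonneg[OF f] by linarith
qed

lemma dual_ball_iff:
  "f \<in> closed_unit_ball (dual_space Z) \<longleftrightarrow>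
    f \<in> bounded_functionals Z \<and> (\<forall>x\<in>carrier Z. \<bar>f x\<bar> \<le> nrm Z x)"
proof
  assume "f \<in> closed_unit_ball (dual_space Z)"
  then have f: "f \<in> bounded_functionals Z" "nrm (dual_space Z) f \<le> 1"
    by (simp_all add: closed_unit_ball_def)
  have "\<bar>f x\<bar> \<le> nrm Z x" if x: "x \<in> carrier Z" for x
  proof -
    have "\<bar>f x\<bar> \<le> nrm (dual_space Z) f * nrm Z x" by (rule abs_le_dual_norm[OF f(1) x])
    also have "\<dots> \<le> 1 * nrm Z x" using f(2) nrm_nonneg[OF x] by (rule mult_right_mono)
    finally show ?thesis by simp
  qed
  with f show "f \<in> bounded_functionals Z \<and> (\<forall>x\<in>carrier Z. \<bar>f x\<bar> \<le> nrm Z x)" by blast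
next
  assume f: "f \<in> bounded_functionals Z \<and> (\<forall>x\<in>carrier Z. \<bar>f x\<bar> \<le> nrm Z x)"
  have "nrm (dual_space Z) f \<le> 1"
  proof (rule dual_norm_le)
    show "\<bar>f x\<bar> \<le> 1" if "x \<in> closed_unit_ball Z" for x
    proof -
      have "\<bar>f x\<bar> \<le> nrm Z x" "nrm Z x \<le> 1"
        using f that by (auto simp: closed_unit_ball_def)
      then show ?thesis by (rule order_trans)
    qed
  qed
  then show "f \<in> closed_unit_ball (dual_space Z)"
    using f by (simp add: closed_unit_ball_def)
qed

end

text \<open>
  The norm topology of the dual is finer than its weak topology, because the bidual functionals are
  bounded and additive.
\<close>

lemma weak_open_contains_dual_norm_ball:
  assumes W: "openin (weak_topology (dual_space Z)) W" "f \<in> W"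
    and f: "f \<in> bounded_functionals Z"
    and nonneg: "\<And>g. g \<in> bounded_functionals Z \<Longrightarrow> 0 \<le> nrm (dual_space Z) g"
  obtains \<epsilon> where "0 < \<epsilon>"
    "\<And>g. \<lbrakk>g \<in> bounded_functionals Z; nrm (dual_space Z) (\<lambda>x. g x - f x) < \<epsilon>\<rbrakk> \<Longrightarrow> g \<in> W"
proof -
  let ?D = "dual_space Z"
  let ?d = "\<lambda>g. nrm ?D (\<lambda>x. g x - f x)"
  \<comment> \<open>the trace on the dual of the filter of norm neighbourhoods of \<open>f\<close>\<close>
  define F where "F = inf (filtercomap ?d (nhds 0)) (principal (bounded_functionals Z))"
  have d: "(?d \<longlongrightarrow> 0) F"
    unfolding F_def by (intro tendsto_mono[OF inf_le1] filterlim_filtercomap)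
  have ev: "eventually (\<lambda>g. g \<in> bounded_functionals Z) F"
    unfolding F_def by (simp add: eventually_inf_principal)
  have "eventually (\<lambda>g. g \<in> W) F"
  proof (rule eventually_in_initial_topology_open[OF W[unfolded weak_topology_def]])
    show "eventually (\<lambda>g. g \<in> carrier ?D) F" using ev by simp
    fix \<phi> assume phi: "\<phi> \<in> carrier (dual_space ?D)"
    then obtain B where B: "\<And>g. g \<in> bounded_functionals Z \<Longrightarrow> \<bar>\<phi> g\<bar> \<le> B * nrm ?D g"
      using bounded_functionalsD(3)[of \<phi> ?D] by auto
    have "\<bar>\<phi> g - \<phi> f\<bar> \<le> B * ?d g" if g: "g \<in> bounded_functionals Z" for g
    proof -
      have h: "(\<lambda>x. g x - f x) \<in> bounded_functionals Z" by (rule bounded_functionals_diff[OF g f])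
      have "\<phi> g = \<phi> (\<lambda>x. g x - f x) + \<phi> f"
        using bounded_functionalsD(1)[of \<phi> ?D "\<lambda>x. g x - f x" f] phi h f by simp
      then show ?thesis using B[OF h] by simp
    qed
    then have "eventually (\<lambda>g. norm (\<phi> g - \<phi> f) \<le> B * ?d g) F"
      using ev by (auto elim: eventually_mono)
    moreover have "((\<lambda>g. B * ?d g) \<longlongrightarrow> 0) F" using tendsto_mult_left[OF d, of B] by simp
    ultimately have "((\<lambda>g. \<phi> g - \<phi> f) \<longlongrightarrow> 0) F" by (rule Lim_null_comparison)
    then show "((\<lambda>g. \<phi> g) \<longlongrightarrow> \<phi> f) F" by (simp add: LIM_zero_iff)
  qed
  then obtain P where P: "eventually P (nhds 0)" "\<And>g. P (?d g) \<Longrightarrow> g \<in> bounded_functionals Z \<Longrightarrow> g \<in> W"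
    unfolding F_def eventually_inf_principal eventually_filtercomap by auto
  then obtain \<epsilon> where "\<epsilon> > 0" "\<And>t. \<bar>t\<bar> < \<epsilon> \<Longrightarrow> P t"
    unfolding eventually_nhds_metric by auto
  then show ?thesis
    using that[of \<epsilon>] P(2) nonneg bounded_functionals_diff[OF _ f] by (smt (verit, best))
qed

lemma topspace_dual_topologies:
  assumes "carrier Z \<noteq> {}"
  shows "topspace (weak_star_topology Z) = bounded_functionals Z"
    and "topspace (weak_topology Z) = carrier Z"
  unfolding weak_star_topology_def weak_topology_def
  using assms zero_bounded_functional[of Z] by (subst topspace_initial_topology; auto)+

context real_normed_space
begin

lemma topspace_weak_star: "topspace (weak_star_topology Z) = bounded_functionals Z"
  by (rule topspace_dual_topologies) auto

lemma topspace_weak_dual: "topspace (weak_topology (dual_space Z)) = bounded_functionals Z"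
  using zero_bounded_functional[of Z] by (subst topspace_dual_topologies) auto

text \<open>
  Inside the dual ball it suffices that closeness on finitely many vectors forces closeness in norm:
  this is continuity from the weak* to the norm topology, and the latter is finer than the weak one.
\<close>

lemma namioka_pointI:
  assumes f: "f \<in> closed_unit_ball (dual_space Z)"
    and close: "\<And>\<epsilon>. 0 < \<epsilon> \<Longrightarrow> \<exists>A \<delta>. finite A \<and> A \<subseteq> carrier Z \<and> 0 < \<delta> \<and>
      (\<forall>g\<in>closed_unit_ball (dual_space Z).
        (\<forall>x\<in>A. \<bar>g x - f x\<bar> < \<delta>) \<longrightarrow> nrm (dual_space Z) (\<lambda>x. g x - f x) < \<epsilon>)"
  shows "namioka_point Z f"
  unfolding namioka_point_def topcontinuous_at_def id_apply
proof (intro conjI allI impI)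
  let ?D = "dual_space Z"
  let ?B = "closed_unit_ball ?D"
  have fD: "f \<in> bounded_functionals Z" using f by (simp add: dual_ball_iff)
  have BD: "?B \<subseteq> bounded_functionals Z" by (auto simp: dual_ball_iff)
  show "f \<in> ?B" by fact
  show "f \<in> topspace (subtopology (weak_star_topology Z) ?B)"
    using f fD by (simp add: topspace_weak_star)
  show "(\<lambda>x. x) \<in> topspace (subtopology (weak_star_topology Z) ?B) \<rightarrow>
      topspace (subtopology (weak_topology ?D) ?B)"
    by (simp add: topspace_weak_star topspace_weak_dual)
  fix V assume "openin (subtopology (weak_topology ?D) ?B) V \<and> f \<in> V"
  then obtain W where W: "openin (weak_topology ?D) W" "V = W \<inter> ?B" "f \<in> W"
    by (auto simp: openin_subtopology)
  obtain \<epsilon> where \<epsilon>: "0 < \<epsilon>"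
    "\<And>g. \<lbrakk>g \<in> bounded_functionals Z; nrm ?D (\<lambda>x. g x - f x) < \<epsilon>\<rbrakk> \<Longrightarrow> g \<in> W"
    using weak_open_contains_dual_norm_ball[OF W(1,3) fD dual_norm_nonneg] by blast
  obtain A \<delta> where A: "finite A" "A \<subseteq> carrier Z" "0 < \<delta>" and
    near: "\<forall>g\<in>?B. (\<forall>x\<in>A. \<bar>g x - f x\<bar> < \<delta>) \<longrightarrow> nrm ?D (\<lambda>x. g x - f x) < \<epsilon>"
    using close[OF \<epsilon>(1)] by (elim exE conjE)
  define U where "U = topspace (weak_star_topology Z) \<inter> \<Inter> ((\<lambda>x. {g \<in> bounded_functionals Z. g x \<in> ball (f x) \<delta>}) ` A)"
  have "openin (weak_star_topology Z) U"
  proof (cases "A = {}")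
    case True
    then show ?thesis by (simp add: U_def)
  next
    case False
    have "openin (weak_star_topology Z) {g \<in> bounded_functionals Z. g x \<in> ball (f x) \<delta>}" if "x \<in> A" for x
      using openin_initial_topology_preimage[of "\<lambda>g. g x" "(\<lambda>x f. f x) ` carrier Z" "ball (f x) \<delta>"] A(2) that
      unfolding weak_star_topology_def by auto
    then show ?thesis
      unfolding U_def using A(1) False by (intro openin_Int openin_Inter openin_topspace) auto
  qed
  moreover have "f \<in> U \<inter> ?B"
    using A(3) f fD by (simp add: U_def topspace_weak_star)
  moreover have "g \<in> V" if "g \<in> U \<inter> ?B" for g
  proof -
    have "\<bar>g x - f x\<bar> < \<delta>" if "x \<in> A" for x
      using \<open>g \<in> U \<inter> ?B\<close> that by (auto simp: U_def dist_real_def)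
    then have "nrm ?D (\<lambda>x. g x - f x) < \<epsilon>" using near that by blast
    then show ?thesis using \<epsilon>(2) that W(2) BD by blast
  qed
  ultimately show "\<exists>U. openin (subtopology (weak_star_topology Z) ?B) U \<and> f \<in> U \<and> (\<forall>y\<in>U. y \<in> V)"
    by (intro exI[of _ "U \<inter> ?B"] conjI ballI openin_subtopology_Int)
qed

text \<open>
  The sequential form of continuity at a Namioka point, used below to show that a functional is not one.
\<close>

lemma namioka_point_weak_limit:
  assumes f: "namioka_point Z f"
    and g: "\<And>n. g n \<in> closed_unit_ball (dual_space Z)"
    and lim: "\<And>x. x \<in> carrier Z \<Longrightarrow> (\<lambda>n::nat. g n x) \<longlonglongrightarrow> f x"
    and W: "openin (weak_topology (dual_space Z)) W" "f \<in> W"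
  shows "eventually (\<lambda>n. g n \<in> W) sequentially"
proof -
  let ?D = "dual_space Z"
  let ?B = "closed_unit_ball ?D"
  have "openin (subtopology (weak_topology ?D) ?B) (W \<inter> ?B)" "f \<in> W \<inter> ?B"
    using W f by (auto simp: openin_subtopology namioka_point_def)
  then obtain U where U: "openin (subtopology (weak_star_topology Z) ?B) U" "f \<in> U" "\<forall>y\<in>U. y \<in> W \<inter> ?B"
    using f unfolding namioka_point_def topcontinuous_at_def id_apply by meson
  then obtain T where T: "openin (weak_star_topology Z) T" "U = T \<inter> ?B"
    by (auto simp: openin_subtopology)
  have "eventually (\<lambda>n. g n \<in> T) sequentially"
  proof (rule eventually_in_initial_topology_open[OF T(1)[unfolded weak_star_topology_def]])
    show "f \<in> T" using U T by blast
    show "eventually (\<lambda>n. g n \<in> carrier ?D) sequentially"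
      using g by (auto simp: dual_ball_iff)
    show "(\<lambda>n. \<phi> (g n)) \<longlonglongrightarrow> \<phi> f" if "\<phi> \<in> (\<lambda>x f. f x) ` carrier Z" for \<phi>
      using that lim by auto
  qed
  then show ?thesis using g U(3) T(2) by (auto elim!: eventually_mono)
qed

end

section \<open>Convergent sequences with an extra Euclidean coordinate\<close>

text \<open>
  The entry at index \<open>0\<close> is the extra coordinate and the entries at positive indices are the terms of
  the sequence. Changing one entry does not affect the limit, so a single convergent sequence encodes the
  pair.
\<close>

definition conv_norm :: "(nat \<Rightarrow> real) \<Rightarrow> real"
  where "conv_norm x = max (SUP i. \<bar>x (Suc i)\<bar>) (sqrt ((lim x)\<^sup>2 + (x 0)\<^sup>2))"

lemma convergent_bdd_above_abs:
  fixes x :: "nat \<Rightarrow> real"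
  assumes "convergent x"
  shows "bdd_above (range (\<lambda>i. \<bar>x (Suc i)\<bar>))"
proof -
  obtain K where "\<And>i. norm (x i) \<le> K"
    using convergent_imp_Bseq[OF assms] unfolding Bseq_def by auto
  then show ?thesis by (intro bdd_aboveI2[of _ _ K]) auto
qed

lemma conv_norm_le_iff:
  assumes "convergent x"
  shows "conv_norm x \<le> C \<longleftrightarrow> (\<forall>i. \<bar>x (Suc i)\<bar> \<le> C) \<and> sqrt ((lim x)\<^sup>2 + (x 0)\<^sup>2) \<le> C"
  unfolding conv_norm_def using convergent_bdd_above_abs[OF assms]
  by (simp add: cSUP_le_iff)

lemma conv_norm_leI:
  assumes "convergent x" "0 \<le> C" "\<And>i. 0 < i \<Longrightarrow> \<bar>x i\<bar> \<le> C" "(lim x)\<^sup>2 + (x 0)\<^sup>2 \<le> C\<^sup>2"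
  shows "conv_norm x \<le> C"
  using assms by (simp add: conv_norm_le_iff real_le_lsqrt)

lemma conv_norm_ge:
  assumes "convergent x"
  shows "\<bar>x i\<bar> \<le> conv_norm x" "\<bar>lim x\<bar> \<le> conv_norm x" "(lim x)\<^sup>2 + (x 0)\<^sup>2 \<le> (conv_norm x)\<^sup>2"
    "0 \<le> conv_norm x"
proof -
  have b: "(\<forall>i. \<bar>x (Suc i)\<bar> \<le> conv_norm x)" "sqrt ((lim x)\<^sup>2 + (x 0)\<^sup>2) \<le> conv_norm x"
    using conv_norm_le_iff[OF assms, of "conv_norm x"] by auto
  have "\<bar>x 0\<bar> \<le> conv_norm x" by (rule order_trans[OF _ b(2)]) simp
  then show "\<bar>x i\<bar> \<le> conv_norm x" using b(1) by (cases i) auto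
  have "\<bar>lim x\<bar> \<le> sqrt ((lim x)\<^sup>2 + (x 0)\<^sup>2)" by simp
  then show "\<bar>lim x\<bar> \<le> conv_norm x" using b(2) by linarith
  then show "0 \<le> conv_norm x" by linarith
  then show "(lim x)\<^sup>2 + (x 0)\<^sup>2 \<le> (conv_norm x)\<^sup>2"
    using b(2) sqrt_le_D by blast
qed

lemma lim_add:
  fixes x y :: "nat \<Rightarrow> real"
  assumes "convergent x" "convergent y"
  shows "lim (\<lambda>i. x i + y i) = lim x + lim y"
  using assms by (intro limI tendsto_add) (simp_all add: convergent_LIMSEQ_iff)

lemma lim_cmult:
  fixes x :: "nat \<Rightarrow> real"
  assumes "convergent x"
  shows "lim (\<lambda>i. c * x i) = c * lim x"
  using assms by (intro limI tendsto_mult_left) (simp_all add: convergent_LIMSEQ_iff)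

lemma conv_norm_zero: "conv_norm (\<lambda>i. 0) = 0"
  by (simp add: conv_norm_def)

lemma conv_norm_eq_zero:
  assumes "convergent x" "conv_norm x = 0"
  shows "x = (\<lambda>i. 0)"
  using conv_norm_ge(1)[OF assms(1)] assms(2) by auto

lemma conv_norm_triangle:
  assumes "convergent x" "convergent y"
  shows "conv_norm (\<lambda>i. x i + y i) \<le> conv_norm x + conv_norm y"
proof -
  have "\<bar>x i + y i\<bar> \<le> conv_norm x + conv_norm y" for i
    using conv_norm_ge(1)[OF assms(1), of i] conv_norm_ge(1)[OF assms(2), of i] by linarith
  moreover have "sqrt ((lim x + lim y)\<^sup>2 + (x 0 + y 0)\<^sup>2) \<le> conv_norm x + conv_norm y"
    using real_sqrt_sum_squares_triangle_ineq[of "lim x" "lim y" "x 0" "y 0"]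
      conv_norm_le_iff[OF assms(1), of "conv_norm x"] conv_norm_le_iff[OF assms(2), of "conv_norm y"]
    by auto
  ultimately show ?thesis
    using assms by (simp add: conv_norm_le_iff convergent_add lim_add)
qed

lemma conv_norm_cmult_le:
  assumes "convergent x"
  shows "conv_norm (\<lambda>i. c * x i) \<le> \<bar>c\<bar> * conv_norm x"
proof (rule conv_norm_leI)
  show "convergent (\<lambda>i. c * x i)" using assms by (intro convergent_mult convergent_const)
  show "0 \<le> \<bar>c\<bar> * conv_norm x" using conv_norm_ge(4)[OF assms] by simp
  show "\<bar>c * x i\<bar> \<le> \<bar>c\<bar> * conv_norm x" for i
    using conv_norm_ge(1)[OF assms, of i] by (simp add: abs_mult mult_left_mono)
  have "(lim (\<lambda>i. c * x i))\<^sup>2 + (c * x 0)\<^sup>2 = c\<^sup>2 * ((lim x)\<^sup>2 + (x 0)\<^sup>2)"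
    by (simp add: lim_cmult[OF assms] power_mult_distrib distrib_left)
  also have "\<dots> \<le> c\<^sup>2 * (conv_norm x)\<^sup>2"
    by (intro mult_left_mono conv_norm_ge(3)[OF assms]) simp
  finally show "(lim (\<lambda>i. c * x i))\<^sup>2 + (c * x 0)\<^sup>2 \<le> (\<bar>c\<bar> * conv_norm x)\<^sup>2"
    by (simp add: power_mult_distrib)
qed

lemma conv_norm_cmult:
  assumes "convergent x"
  shows "conv_norm (\<lambda>i. c * x i) = \<bar>c\<bar> * conv_norm x"
proof (cases "c = 0")
  case True
  then show ?thesis by (simp add: conv_norm_zero)
next
  case False
  have "convergent (\<lambda>i. c * x i)" using assms by (intro convergent_mult convergent_const)
  then have "conv_norm (\<lambda>i. inverse c * (c * x i)) \<le> \<bar>inverse c\<bar> * conv_norm (\<lambda>i. c * x i)"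
    by (rule conv_norm_cmult_le)
  then have "\<bar>c\<bar> * conv_norm x \<le> conv_norm (\<lambda>i. c * x i)"
    using False by (simp add: field_simps)
  then show ?thesis using conv_norm_cmult_le[OF assms, of c] by simp
qed

text \<open>
  The carrier is a parameter so that the whole space and its hyperplane are instances of the same
  construction.
\<close>

definition seq_space :: "(nat \<Rightarrow> real) set \<Rightarrow> (nat \<Rightarrow> real) normed_structure"
  where "seq_space V =
    \<lparr>carrier = V, monoid.mult = undefined, one = undefined,
     zero = (\<lambda>i. 0), add = (\<lambda>x y i. x i + y i), smult = (\<lambda>c x i. c * x i), nrm = conv_norm\<rparr>"

lemma seq_space_sel [simp]:
  "carrier (seq_space V) = V"
  "\<zero>\<^bsub>seq_space V\<^esub> = (\<lambda>i. 0)"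
  "x \<oplus>\<^bsub>seq_space V\<^esub> y = (\<lambda>i. x i + y i)"
  "c \<odot>\<^bsub>seq_space V\<^esub> x = (\<lambda>i. c * x i)"
  "nrm (seq_space V) = conv_norm"
  "(seq_space V)\<lparr>carrier := W\<rparr> = seq_space W"
  by (simp_all add: seq_space_def)

definition convergent_subspace :: "(nat \<Rightarrow> real) set \<Rightarrow> bool"
  where "convergent_subspace V \<longleftrightarrow> V \<subseteq> Collect convergent \<and> (\<lambda>i. 0) \<in> V \<and>
    (\<forall>x\<in>V. \<forall>y\<in>V. (\<lambda>i. x i + y i) \<in> V) \<and> (\<forall>c. \<forall>x\<in>V. (\<lambda>i. c * x i) \<in> V)"

lemma real_normed_space_seq_space:
  assumes "convergent_subspace V"
  shows "real_normed_space (seq_space V)"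
proof -
  note V = assms[unfolded convergent_subspace_def]
  have neg: "\<exists>y\<in>V. (\<lambda>i. y i + x i) = (\<lambda>i. 0)" if "x \<in> V" for x
  proof
    show "(\<lambda>i. -1 * x i) \<in> V" using V that by blast
  qed simp
  have "module real_field (seq_space V)"
  proof (rule moduleI)
    show "cring real_field" by (rule cring_from_type_algebra)
    show "abelian_group (seq_space V)"
      by (rule abelian_groupI) (use V neg in \<open>auto simp: algebra_simps\<close>)
  qed (use V in \<open>auto simp: ring_of_type_algebra_def algebra_simps\<close>)
  moreover have "real_normed_space_axioms (seq_space V)"
  proof
    fix x y c
    assume "x \<in> carrier (seq_space V)"
    then have x: "convergent x" using V by auto
    show "0 \<le> nrm (seq_space V) x" using conv_norm_ge(4)[OF x] by simp
    show "nrm (seq_space V) x = 0 \<longleftrightarrow> x = \<zero>\<^bsub>seq_space V\<^esub>"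
      using conv_norm_eq_zero[OF x] by (auto simp: conv_norm_zero)
    show "nrm (seq_space V) (c \<odot>\<^bsub>seq_space V\<^esub> x) = \<bar>c\<bar> * nrm (seq_space V) x"
      using conv_norm_cmult[OF x] by simp
    assume "y \<in> carrier (seq_space V)"
    then have "convergent y" using V by auto
    then show "nrm (seq_space V) (x \<oplus>\<^bsub>seq_space V\<^esub> y) \<le> nrm (seq_space V) x + nrm (seq_space V) y"
      using conv_norm_triangle[OF x] by simp
  qed
  ultimately show ?thesis by (rule real_normed_space.intro)
qed

lemma seq_space_minus:
  assumes V: "convergent_subspace V" and x: "x \<in> V" and y: "y \<in> V"
  shows "\<ominus>\<^bsub>seq_space V\<^esub> y = (\<lambda>i. - y i)" and "x \<ominus>\<^bsub>seq_space V\<^esub> y = (\<lambda>i. x i - y i)"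
proof -
  interpret real_normed_space "seq_space V" by (rule real_normed_space_seq_space[OF V])
  have "(\<lambda>i. -1 * y i) \<in> V" using V y unfolding convergent_subspace_def by blast
  then show m: "\<ominus>\<^bsub>seq_space V\<^esub> y = (\<lambda>i. - y i)"
    using y by (intro minus_equality) auto
  show "x \<ominus>\<^bsub>seq_space V\<^esub> y = (\<lambda>i. x i - y i)"
    unfolding a_minus_def m by simp
qed

abbreviation conv_space :: "(nat \<Rightarrow> real) normed_structure"
  where "conv_space \<equiv> seq_space (Collect convergent)"

definition conv_hyperplane :: "(nat \<Rightarrow> real) set"
  where "conv_hyperplane = {x. convergent x \<and> x 0 = 0}"

lemma convergent_subspace_all: "convergent_subspace (Collect convergent)"
  unfolding convergent_subspace_def
  by (auto intro: convergent_const convergent_add convergent_mult)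

lemma convergent_subspace_hyperplane: "convergent_subspace conv_hyperplane"
  unfolding convergent_subspace_def conv_hyperplane_def
  by (auto intro: convergent_const convergent_add convergent_mult)

interpretation conv_space: real_normed_space conv_space
  by (rule real_normed_space_seq_space[OF convergent_subspace_all])

interpretation conv_hyperplane: real_normed_space "seq_space conv_hyperplane"
  by (rule real_normed_space_seq_space[OF convergent_subspace_hyperplane])

lemma conv_space_dist:
  "nrm_dist conv_space x y =
    (if convergent x \<and> convergent y then conv_norm (\<lambda>i. x i - y i) else 0)"
  unfolding nrm_dist_def using seq_space_minus(2)[OF convergent_subspace_all] by simp

interpretation conv_metric: Metric_space "Collect convergent" "nrm_dist conv_space"
proof
  fix x y z :: "nat \<Rightarrow> real"
  have diff: "convergent (\<lambda>i. x i - y i)" if "convergent x" "convergent y" for x y :: "nat \<Rightarrow> real"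
    using that by (rule convergent_diff)
  show "0 \<le> nrm_dist conv_space x y"
    by (simp add: conv_space_dist conv_norm_ge(4) diff)
  have "conv_norm (\<lambda>i. x i - y i) = conv_norm (\<lambda>i. y i - x i)" if "convergent x" "convergent y"
    using conv_norm_cmult[OF diff[OF that], of "-1"] by simp
  then show "nrm_dist conv_space x y = nrm_dist conv_space y x"
    by (simp add: conv_space_dist)
  assume x: "x \<in> Collect convergent" and y: "y \<in> Collect convergent"
  show "nrm_dist conv_space x y = 0 \<longleftrightarrow> x = y"
    using x y conv_norm_eq_zero[OF diff[of x y]] by (auto simp: conv_space_dist conv_norm_zero fun_eq_iff)
  assume z: "z \<in> Collect convergent"
  show "nrm_dist conv_space x z \<le> nrm_dist conv_space x y + nrm_dist conv_space y z"
    using conv_norm_triangle[OF diff[of x y] diff[of y z]] x y z by (simp add: conv_space_dist)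
qed

text \<open>
  Since the limit is bounded by the supremum, the norm is equivalent to the supremum norm. Completeness
  below is inherited from uniform convergence in this way.
\<close>

lemma conv_norm_le_sup:
  assumes "convergent x" "\<And>i. \<bar>x i\<bar> \<le> C"
  shows "conv_norm x \<le> 2 * C"
proof (rule conv_norm_leI)
  have C: "0 \<le> C" using assms(2)[of 0] by simp
  then show "0 \<le> 2 * C" by simp
  show "\<bar>x i\<bar> \<le> 2 * C" for i using assms(2)[of i] C by simp
  have "\<bar>lim x\<bar> \<le> C"
    using assms by (intro Lim_bounded[of "\<lambda>i. \<bar>x i\<bar>"]) (auto simp: convergent_LIMSEQ_iff intro: tendsto_rabs)
  then have "(lim x)\<^sup>2 \<le> C\<^sup>2" "(x 0)\<^sup>2 \<le> C\<^sup>2"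
    using assms(2)[of 0] C by (simp_all add: abs_le_square_iff[symmetric])
  moreover have "(2 * C)\<^sup>2 = 4 * C\<^sup>2" "0 \<le> C\<^sup>2" by simp_all
  ultimately show "(lim x)\<^sup>2 + (x 0)\<^sup>2 \<le> (2 * C)\<^sup>2" by linarith
qed (use assms in auto)

lemma real_banach_space_conv_space: "real_banach_space conv_space"
  unfolding real_banach_space_def seq_space_sel conv_metric.mcomplete_def
proof (intro conjI allI impI)
  show "real_normed_space conv_space" by (rule conv_space.real_normed_space_axioms)
  fix \<sigma> assume "conv_metric.MCauchy \<sigma>"
  then have conv: "convergent (\<sigma> n)"
    and cau: "\<And>e. 0 < e \<Longrightarrow> \<exists>K. \<forall>n n'. K \<le> n \<longrightarrow> K \<le> n' \<longrightarrow> nrm_dist conv_space (\<sigma> n) (\<sigma> n') < e" for n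
    unfolding conv_metric.MCauchy_def by auto
  have unif: "\<exists>K. \<forall>n\<ge>K. \<forall>n'\<ge>K. \<forall>i. \<bar>\<sigma> n i - \<sigma> n' i\<bar> < e" if e: "0 < e" for e
  proof -
    obtain K where "\<forall>n n'. K \<le> n \<longrightarrow> K \<le> n' \<longrightarrow> nrm_dist conv_space (\<sigma> n) (\<sigma> n') < e"
      using cau[OF e] by blast
    then have K: "conv_norm (\<lambda>i. \<sigma> n i - \<sigma> n' i) < e" if "K \<le> n" "K \<le> n'" for n n'
      using that conv by (simp add: conv_space_dist)
    have "\<bar>\<sigma> n i - \<sigma> n' i\<bar> < e" if "K \<le> n" "K \<le> n'" for n n' i
      using conv_norm_ge(1)[OF convergent_diff[OF conv conv], of n i n'] K[OF that] by simp
    then show ?thesis by blast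
  qed
  define x where "x i = lim (\<lambda>n. \<sigma> n i)" for i
  have ptw: "(\<lambda>n. \<sigma> n i) \<longlonglongrightarrow> x i" for i
  proof -
    have "Cauchy (\<lambda>n. \<sigma> n i)"
      unfolding Cauchy_def dist_real_def using unif by meson
    then show ?thesis
      unfolding x_def by (simp add: Cauchy_convergent_iff convergent_LIMSEQ_iff)
  qed
  have near: "\<exists>K. \<forall>n\<ge>K. \<forall>i. \<bar>\<sigma> n i - x i\<bar> \<le> e" if e: "0 < e" for e
  proof -
    obtain K where K: "\<And>n n' i. n \<ge> K \<Longrightarrow> n' \<ge> K \<Longrightarrow> \<bar>\<sigma> n i - \<sigma> n' i\<bar> < e" using unif[OF e] by blast
    have "\<bar>\<sigma> n i - x i\<bar> \<le> e" if "n \<ge> K" for n i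
    proof (rule Lim_bounded)
      show "(\<lambda>n'. \<bar>\<sigma> n i - \<sigma> n' i\<bar>) \<longlonglongrightarrow> \<bar>\<sigma> n i - x i\<bar>"
        by (intro tendsto_rabs tendsto_diff tendsto_const ptw)
      show "\<forall>n'\<ge>K. \<bar>\<sigma> n i - \<sigma> n' i\<bar> \<le> e" using K[OF that] less_imp_le by blast
    qed
    then show ?thesis by blast
  qed
  have x: "convergent x"
  proof -
    have "Cauchy x"
      unfolding Cauchy_def dist_real_def
    proof (intro allI impI)
      fix e :: real assume "0 < e"
      then obtain n where n: "\<And>i. \<bar>\<sigma> n i - x i\<bar> \<le> e / 4" using near[of "e / 4"] by auto
      obtain M where M: "\<forall>i\<ge>M. \<forall>j\<ge>M. \<bar>\<sigma> n i - \<sigma> n j\<bar> < e / 4"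
        using convergent_Cauchy[OF conv[of n]] \<open>0 < e\<close> unfolding Cauchy_def dist_real_def
        by (meson divide_pos_pos zero_less_numeral)
      have "\<bar>x i - x j\<bar> < e" if "i \<ge> M" "j \<ge> M" for i j
      proof -
        have "\<bar>\<sigma> n i - \<sigma> n j\<bar> < e / 4" using M that by blast
        then show ?thesis using n[of i] n[of j] \<open>0 < e\<close> by linarith
      qed
      then show "\<exists>M. \<forall>i\<ge>M. \<forall>j\<ge>M. \<bar>x i - x j\<bar> < e" by blast
    qed
    then show ?thesis by (rule Cauchy_convergent)
  qed
  have "\<exists>N. \<forall>n\<ge>N. \<sigma> n \<in> Collect convergent \<and> nrm_dist conv_space (\<sigma> n) x < e" if e: "0 < e" for e
  proof -
    obtain K where K: "\<And>n i. n \<ge> K \<Longrightarrow> \<bar>\<sigma> n i - x i\<bar> \<le> e / 3" using near[of "e / 3"] e by auto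
    have "conv_norm (\<lambda>i. \<sigma> n i - x i) < e" if "n \<ge> K" for n
      using conv_norm_le_sup[OF convergent_diff[OF conv x] K[OF that]] e by simp
    then show ?thesis using conv x by (auto simp: conv_space_dist)
  qed
  then show "\<exists>x. limitin conv_metric.mtopology \<sigma> x sequentially"
    using x unfolding conv_metric.limit_metric_sequentially by blast
qed

lemma closed_subspace_conv_hyperplane: "closed_subspace conv_hyperplane conv_space"
  unfolding closed_subspace_def seq_space_sel
proof
  show "submodule conv_hyperplane real_field conv_space"
  proof (rule conv_space.module_incl_imp_submodule)
    show "conv_hyperplane \<subseteq> carrier conv_space" by (auto simp: conv_hyperplane_def)
    show "module real_field (conv_space\<lparr>carrier := conv_hyperplane\<rparr>)"
      using conv_hyperplane.module_axioms by simp
  qed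
  show "closedin conv_metric.mtopology conv_hyperplane"
    unfolding conv_metric.closedin_metric
  proof (intro conjI allI impI)
    show "conv_hyperplane \<subseteq> Collect convergent" by (auto simp: conv_hyperplane_def)
    fix x :: "nat \<Rightarrow> real" assume "x \<in> Collect convergent - conv_hyperplane"
    then have x: "convergent x" "x 0 \<noteq> 0" by (auto simp: conv_hyperplane_def)
    have "y 0 \<noteq> 0" if "y \<in> conv_metric.mball x \<bar>x 0\<bar>" for y
    proof -
      have y: "convergent y" "conv_norm (\<lambda>i. x i - y i) < \<bar>x 0\<bar>"
        using that x by (auto simp: conv_metric.in_mball conv_space_dist)
      then show ?thesis using conv_norm_ge(1)[OF convergent_diff[OF x(1) y(1)], of 0] by auto
    qed
    then have "disjnt conv_hyperplane (conv_metric.mball x \<bar>x 0\<bar>)"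
      unfolding disjnt_iff conv_hyperplane_def by blast
    then show "\<exists>r>0. disjnt conv_hyperplane (conv_metric.mball x r)"
      using x(2) by (intro exI[of _ "\<bar>x 0\<bar>"]) simp
  qed
qed

section \<open>Property (N) of the large space\<close>

lemma functional_linear:
  assumes "f \<in> bounded_functionals (seq_space V)"
  shows "\<lbrakk>x \<in> V; y \<in> V\<rbrakk> \<Longrightarrow> f (\<lambda>i. x i + y i) = f x + f y"
    and "x \<in> V \<Longrightarrow> f (\<lambda>i. c * x i) = c * f x"
  using bounded_functionalsD(1,2)[OF assms] by simp_all

lemma functional_sum:
  assumes V: "convergent_subspace V" and f: "f \<in> bounded_functionals (seq_space V)"
    and y: "\<And>j. j \<in> A \<Longrightarrow> y j \<in> V" and fin: "finite A"
  shows "(\<lambda>i. \<Sum>j\<in>A. c j * y j i) \<in> V \<and> f (\<lambda>i. \<Sum>j\<in>A. c j * y j i) = (\<Sum>j\<in>A. c j * f (y j))"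
  using fin y
proof induction
  case empty
  have "(\<lambda>i. 0) \<in> V" using V unfolding convergent_subspace_def by blast
  then show ?case using functional_linear(2)[OF f, of "\<lambda>i. 0" 0] by simp
next
  case (insert a A)
  have 1: "(\<lambda>i. c a * y a i) \<in> V" using V insert unfolding convergent_subspace_def by blast
  have 2: "(\<lambda>i. \<Sum>j\<in>A. c j * y j i) \<in> V" using insert by blast
  have add: "(\<lambda>i. u i + w i) \<in> V" if "u \<in> V" "w \<in> V" for u w
    using V that unfolding convergent_subspace_def by blast
  have "f (\<lambda>i. c a * y a i + (\<Sum>j\<in>A. c j * y j i)) = c a * f (y a) + (\<Sum>j\<in>A. c j * f (y j))"
    unfolding functional_linear(1)[OF f 1 2] using insert functional_linear(2)[OF f, of "y a" "c a"] by simp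
  then show ?case
    unfolding sum.insert[OF insert(1,2)] using add[OF 1 2] by simp
qed

lemma LIMSEQ_indicator_singleton: "(indicator {j} :: nat \<Rightarrow> real) \<longlonglongrightarrow> 0"
  by (rule tendsto_eventually) (auto simp: eventually_sequentially intro!: exI[of _ "Suc j"])

lemma LIMSEQ_indicator_greaterThan: "(indicator {n<..} :: nat \<Rightarrow> real) \<longlonglongrightarrow> 1"
  by (rule tendsto_eventually) (auto simp: eventually_sequentially intro!: exI[of _ "Suc n"])

lemma convergent_indicators:
  "convergent (indicator {j} :: nat \<Rightarrow> real)" "convergent (indicator {n<..} :: nat \<Rightarrow> real)"
  using LIMSEQ_indicator_singleton LIMSEQ_indicator_greaterThan by (blast intro: convergentI)+

lemma lim_indicators:
  "lim (indicator {j} :: nat \<Rightarrow> real) = 0" "lim (indicator {n<..} :: nat \<Rightarrow> real) = 1"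
  by (rule limI[OF LIMSEQ_indicator_singleton] limI[OF LIMSEQ_indicator_greaterThan])+

text \<open>
  The vectors \<open>v + (1 - \<kappa>) / 2 * r\<close> and \<open>v - (1 - \<kappa>) / 2 * r\<close> stay in the unit ball: beyond \<open>n\<close> the
  entries of \<open>v\<close> leave room \<open>1 - \<kappa>\<close>, and neither the limit nor the extra coordinate changes. So \<open>g\<close> is
  at most \<open>1\<close> at both of them.
\<close>

lemma slack_controls_null_tail:
  assumes g: "g \<in> closed_unit_ball (dual_space conv_space)"
    and v: "convergent v" "conv_norm v \<le> 1" "\<And>i. n < i \<Longrightarrow> \<bar>v i\<bar> \<le> \<kappa>" and \<kappa>: "\<kappa> < 1"
    and r: "r \<longlonglongrightarrow> 0" "\<And>i. i \<le> n \<Longrightarrow> r i = 0" "\<And>i. \<bar>r i\<bar> \<le> 2"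
  shows "(1 - \<kappa>) / 2 * \<bar>g r\<bar> \<le> 1 - g v"
proof -
  have gB: "g \<in> bounded_functionals conv_space"
    and gle: "\<And>x. convergent x \<Longrightarrow> \<bar>g x\<bar> \<le> conv_norm x"
    using g by (auto simp: conv_space.dual_ball_iff)
  have rc: "convergent r" using r(1) by (rule convergentI)
  have one_sided: "s * ((1 - \<kappa>) / 2 * g r) \<le> 1 - g v" if s: "\<bar>s\<bar> = 1" for s
  proof -
    define c where "c = s * ((1 - \<kappa>) / 2)"
    have c: "\<bar>c\<bar> = (1 - \<kappa>) / 2" using s \<kappa> by (simp add: c_def abs_mult)
    define w where "w i = v i + c * r i" for i
    have crc: "convergent (\<lambda>i. c * r i)" using rc by (intro convergent_mult convergent_const)
    have wc: "convergent w" unfolding w_def by (rule convergent_add[OF v(1) crc])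
    have lw: "lim w = lim v"
      unfolding w_def using lim_add[OF v(1) crc] lim_cmult[OF rc, of c] limI[OF r(1)] by simp
    have "conv_norm w \<le> 1"
    proof (rule conv_norm_leI[OF wc])
      fix i :: nat
      show "\<bar>w i\<bar> \<le> 1"
      proof (cases "i \<le> n")
        case True
        then show ?thesis using conv_norm_ge(1)[OF v(1), of i] v(2) r(2) by (simp add: w_def)
      next
        case False
        have "\<bar>c * r i\<bar> \<le> (1 - \<kappa>) / 2 * 2"
          unfolding abs_mult c using r(3)[of i] \<kappa> by (intro mult_left_mono) auto
        then show ?thesis using v(3)[of i] False by (simp add: w_def)
      qed
    next
      have "(conv_norm v)\<^sup>2 \<le> 1" using v(2) conv_norm_ge(4)[OF v(1)] by (simp add: power_le_one)
      then show "(lim w)\<^sup>2 + (w 0)\<^sup>2 \<le> 1\<^sup>2"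
        using conv_norm_ge(3)[OF v(1)] r(2)[of 0] by (simp add: lw) (simp add: w_def)
    qed simp
    then have "g w \<le> 1" using gle[OF wc] by simp
    moreover have "g w = g v + c * g r"
      unfolding w_def using functional_linear[OF gB] v(1) rc crc by simp
    ultimately show ?thesis by (simp add: c_def)
  qed
  have "1 * ((1 - \<kappa>) / 2 * g r) \<le> 1 - g v" "-1 * ((1 - \<kappa>) / 2 * g r) \<le> 1 - g v"
    by (rule one_sided; simp)+
  then have "\<bar>(1 - \<kappa>) / 2 * g r\<bar> \<le> 1 - g v" by linarith
  then show ?thesis using \<kappa> by (simp add: abs_mult)
qed

text \<open>
  Split a vector \<open>x\<close> of the unit ball into its first entries, its limit times the indicator of a tail, and
  a null tail \<open>r\<close>. The first two parts involve finitely many vectors. For the third, a functional \<open>g\<close> that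
  is weak* close to \<open>f\<close> is nearly \<open>1\<close> at the vector \<open>v\<close> that almost norms \<open>f\<close>, so that both \<open>f\<close> and
  \<open>g\<close> are small at \<open>r\<close> by the slack argument.
\<close>

lemma namioka_point_conv_spaceI:
  assumes f: "f \<in> closed_unit_ball (dual_space conv_space)" and \<kappa>: "\<kappa> < 1"
    and norming: "\<And>\<delta>. 0 < \<delta> \<Longrightarrow>
      \<exists>v. convergent v \<and> conv_norm v \<le> 1 \<and> \<bar>lim v\<bar> \<le> \<kappa> \<and> 1 - \<delta> < f v"
  shows "namioka_point conv_space f"
proof (rule conv_space.namioka_pointI[OF f])
  fix \<epsilon> :: real assume \<epsilon>: "0 < \<epsilon>"
  have fB: "f \<in> bounded_functionals conv_space" using f by (simp add: conv_space.dual_ball_iff)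
  define \<kappa>' where "\<kappa>' = (1 + \<kappa>) / 2"
  have \<kappa>': "\<kappa> < \<kappa>'" "\<kappa>' < 1" using \<kappa> by (simp_all add: \<kappa>'_def)
  define c where "c = (1 - \<kappa>') / 2"
  have c: "0 < c" using \<kappa>' by (simp add: c_def)
  \<comment> \<open>The finitely many vectors contribute at most \<open>\<delta>\<close>, the null tail at most \<open>2 * \<delta> / c\<close> for \<open>g\<close> and
    \<open>\<delta> / c\<close> for \<open>f\<close>.\<close>
  define \<delta> where "\<delta> = \<epsilon> * c / (2 * (c + 3))"
  have \<delta>: "0 < \<delta>" "\<delta> + 3 * \<delta> / c = \<epsilon> / 2"
    using c \<epsilon> by (simp_all add: \<delta>_def divide_simps) (simp add: algebra_simps)
  obtain v where v: "convergent v" "conv_norm v \<le> 1" "\<bar>lim v\<bar> \<le> \<kappa>" "1 - \<delta> < f v"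
    using norming[OF \<delta>(1)] by blast
  have "(\<lambda>i. \<bar>v i\<bar>) \<longlonglongrightarrow> \<bar>lim v\<bar>" using v(1) by (intro tendsto_rabs) (simp add: convergent_LIMSEQ_iff)
  then have "eventually (\<lambda>i. \<bar>v i\<bar> < \<kappa>') sequentially" by (rule order_tendstoD(2)) (use v(3) \<kappa>'(1) in linarith)
  then obtain n where "\<forall>i\<ge>n. \<bar>v i\<bar> < \<kappa>'"
    unfolding eventually_sequentially by (elim exE)
  then have n: "\<bar>v i\<bar> \<le> \<kappa>'" if "n < i" for i
    using that by (simp add: less_imp_le)
  let ?e = "\<lambda>j. indicator {j} :: nat \<Rightarrow> real" and ?t = "indicator {n<..} :: nat \<Rightarrow> real"
  define d where "d = \<delta> / (real n + 2)"
  have d: "0 < d" "(real n + 1) * d + d = \<delta>" "d \<le> \<delta>"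
    using \<delta>(1) by (simp_all add: d_def divide_simps) (simp add: algebra_simps)
  define A where "A = insert v (insert ?t (?e ` {..n}))"
  have "nrm (dual_space conv_space) (\<lambda>x. g x - f x) < \<epsilon>"
    if g: "g \<in> closed_unit_ball (dual_space conv_space)" and near: "\<forall>x\<in>A. \<bar>g x - f x\<bar> < d" for g
  proof -
    have gB: "g \<in> bounded_functionals conv_space" using g by (simp add: conv_space.dual_ball_iff)
    define h where "h x = g x - f x" for x
    have hB: "h \<in> bounded_functionals conv_space"
      unfolding h_def by (rule bounded_functionals_diff[OF gB fB])
    have hA: "\<bar>h a\<bar> \<le> d" if "a \<in> A" for a
      using near that by (simp add: h_def less_imp_le)
    have "\<bar>h x\<bar> \<le> \<epsilon> / 2" if "x \<in> closed_unit_ball conv_space" for x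
    proof -
      have x: "convergent x" "conv_norm x \<le> 1" using that by (simp_all add: closed_unit_ball_def)
      have x1: "\<bar>x i\<bar> \<le> 1" "\<bar>lim x\<bar> \<le> 1" for i
        using conv_norm_ge(1,2)[OF x(1)] x(2) order_trans by blast+
      define r where "r i = (if i \<le> n then 0 else x i - lim x)" for i
      have r0: "r \<longlonglongrightarrow> 0"
      proof (rule Lim_transform_eventually)
        show "(\<lambda>i. x i - lim x) \<longlonglongrightarrow> 0"
          using x(1) by (intro LIM_zero) (simp add: convergent_LIMSEQ_iff)
        show "eventually (\<lambda>i. x i - lim x = r i) sequentially"
          unfolding eventually_sequentially r_def by (intro exI[of _ "Suc n"]) auto
      qed
      have r2: "\<bar>r i\<bar> \<le> 2" for i
      proof -
        have "\<bar>x i - lim x\<bar> \<le> 2" using x1(1)[of i] x1(2) by linarith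
        then show ?thesis by (simp add: r_def)
      qed
      have rn: "r i = 0" if "i \<le> n" for i using that by (simp add: r_def)
      have rc: "convergent r" using r0 by (rule convergentI)
      define s where "s i = (\<Sum>j\<in>{..n}. x j * ?e j i)" for i
      have s: "convergent s" "h s = (\<Sum>j\<in>{..n}. x j * h (?e j))"
        using functional_sum[OF convergent_subspace_all hB, of "{..n}" ?e x] convergent_indicators(1)
        unfolding s_def by simp_all
      define u where "u i = lim x * ?t i" for i
      have u: "convergent u" unfolding u_def by (intro convergent_mult convergent_const convergent_indicators)
      have "x i = (s i + u i) + r i" for i
      proof (cases "i \<le> n")
        case True
        have "s i = (\<Sum>j\<in>{..n}. if j = i then x j else 0)"
          unfolding s_def by (intro sum.cong) (auto simp: indicator_def)
        then show ?thesis using True by (simp add: u_def r_def)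
      next
        case False
        then have "s i = 0" unfolding s_def by (intro sum.neutral) (auto simp: indicator_def)
        then show ?thesis using False by (simp add: u_def r_def)
      qed
      then have "x = (\<lambda>i. (s i + u i) + r i)" by (rule ext)
      then have "h x = h (\<lambda>i. (s i + u i) + r i)" by (rule arg_cong)
      also have "\<dots> = (h s + h u) + h r"
        using functional_linear(1)[OF hB] s(1) u rc convergent_add[OF s(1) u] by simp
      finally have hx: "h x = (\<Sum>j\<in>{..n}. x j * h (?e j)) + lim x * h ?t + h r"
        unfolding s(2) u_def using functional_linear(2)[OF hB] convergent_indicators(2) by simp
      have "\<bar>\<Sum>j\<in>{..n}. x j * h (?e j)\<bar> \<le> (\<Sum>j\<in>{..n}. 1 * d)"
      proof (rule order_trans[OF sum_abs sum_mono])
        fix j assume "j \<in> {..n}"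
        then have "\<bar>h (?e j)\<bar> \<le> d" by (intro hA) (simp add: A_def)
        then show "\<bar>x j * h (?e j)\<bar> \<le> 1 * d" unfolding abs_mult using x1(1)[of j] by (intro mult_mono) auto
      qed
      then have b1: "\<bar>\<Sum>j\<in>{..n}. x j * h (?e j)\<bar> \<le> (real n + 1) * d" by (simp add: algebra_simps)
      have "\<bar>h ?t\<bar> \<le> d" by (rule hA) (simp add: A_def)
      then have b2: "\<bar>lim x * h ?t\<bar> \<le> 1 * d" unfolding abs_mult using x1(2) by (intro mult_mono) auto
      have "\<bar>h v\<bar> \<le> d" by (rule hA) (simp add: A_def)
      then have "g v \<ge> 1 - 2 * \<delta>" using v(4) d(3) unfolding h_def by linarith
      moreover have "c * \<bar>g r\<bar> \<le> 1 - g v" "c * \<bar>f r\<bar> \<le> 1 - f v"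
        unfolding c_def
        by (rule slack_controls_null_tail[where n = n]; fact f g v(1) v(2) n \<kappa>'(2) r0 rn r2)+
      ultimately have "c * (\<bar>g r\<bar> + \<bar>f r\<bar>) \<le> 3 * \<delta>" using v(4) by (simp add: distrib_left)
      then have "\<bar>g r\<bar> + \<bar>f r\<bar> \<le> 3 * \<delta> / c" using c by (simp add: field_simps)
      then have b3: "\<bar>h r\<bar> \<le> 3 * \<delta> / c" unfolding h_def by linarith
      show ?thesis using b1 b2 b3 d(2) \<delta>(2) unfolding hx by linarith
    qed
    then have "nrm (dual_space conv_space) h \<le> \<epsilon> / 2" by (rule conv_space.dual_norm_le)
    then show ?thesis using \<epsilon> unfolding h_def by linarith
  qed
  moreover have "finite A" "A \<subseteq> carrier conv_space"
    using v(1) convergent_indicators by (auto simp: A_def)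
  ultimately show "\<exists>A \<delta>. finite A \<and> A \<subseteq> carrier conv_space \<and> 0 < \<delta> \<and>
      (\<forall>g\<in>closed_unit_ball (dual_space conv_space).
        (\<forall>x\<in>A. \<bar>g x - f x\<bar> < \<delta>) \<longrightarrow> nrm (dual_space conv_space) (\<lambda>x. g x - f x) < \<epsilon>)"
    using d(1) by (intro exI[of _ A] exI[of _ d] conjI ballI impI)
qed

lemma conv_norm_indicator_zero: "conv_norm (indicator {0}) \<le> 1"
  by (rule conv_norm_leI) (simp_all add: convergent_indicators lim_indicators)

text \<open>
  Let \<open>T\<close> be the value of \<open>f\<close> at the unit vector of the extra coordinate and let \<open>v\<close> almost norm \<open>f\<close>. If
  \<open>v 0\<close> is not small, the Euclidean part of the norm keeps the limit of \<open>v\<close> away from \<open>1\<close>. If it is small,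
  then shrinking the terms by the factor \<open>1 - \<eta>\<close> makes room for an extra coordinate of size
  \<open>sqrt \<eta>\<close>. The loss is of order \<open>\<eta>\<close> and the gain is of order \<open>\<bar>T\<bar> * sqrt \<eta>\<close>, so for small
  \<open>\<eta>\<close> the new vector norms \<open>f\<close> at least as well, and its limit is at most \<open>1 - \<eta>\<close> in absolute value.
\<close>

lemma namioka_point_of_unit_sphere:
  assumes f: "f \<in> unit_sphere (dual_space conv_space)" and f0: "f (indicator {0}) \<noteq> 0"
  shows "namioka_point conv_space f"
proof -
  let ?D = "dual_space conv_space" and ?e = "indicator {0} :: nat \<Rightarrow> real"
  define T where "T = f ?e"
  have nf: "nrm ?D f = 1" and fB: "f \<in> bounded_functionals conv_space"
    using f by (simp_all add: unit_sphere_def)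
  have fb: "f \<in> closed_unit_ball ?D" using nf fB by (simp add: closed_unit_ball_def)
  have fle: "\<bar>f x\<bar> \<le> conv_norm x" if "convergent x" for x
    using fb that by (simp add: conv_space.dual_ball_iff)
  have T: "T \<noteq> 0" "\<bar>T\<bar> \<le> 1"
    using f0 fle[OF convergent_indicators(1), of 0] conv_norm_indicator_zero by (simp_all add: T_def)
  have T2: "0 < T\<^sup>2" "T\<^sup>2 \<le> 1" using T by (simp_all add: abs_square_le_1)
  \<comment> \<open>an upper bound for both \<open>sqrt (1 - T\<^sup>2 / 16)\<close> and \<open>1 - T\<^sup>2 / 4\<close>, the bounds in the two cases below\<close>
  define \<kappa> where "\<kappa> = 1 - T\<^sup>2 / 32"
  have "\<exists>v. convergent v \<and> conv_norm v \<le> 1 \<and> \<bar>lim v\<bar> \<le> \<kappa> \<and> 1 - \<delta> < f v" if \<delta>: "0 < \<delta>" for \<delta>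
  proof -
    have "\<exists>u\<in>closed_unit_ball conv_space. 1 - \<delta> < \<bar>f u\<bar>"
    proof (rule ccontr)
      assume "\<not> ?thesis"
      then have "nrm ?D f \<le> 1 - \<delta>" by (intro conv_space.dual_norm_le) (auto simp: not_less)
      then show False using nf \<delta> by simp
    qed
    then obtain u where u: "convergent u" "conv_norm u \<le> 1" "1 - \<delta> < \<bar>f u\<bar>"
      by (auto simp: closed_unit_ball_def)
    define s :: real where "s = (if 0 \<le> f u then 1 else -1)"
    define v where "v i = s * u i" for i
    have v: "convergent v" "conv_norm v \<le> 1" "1 - \<delta> < f v"
      using u convergent_mult[OF convergent_const u(1), of s] conv_norm_cmult[OF u(1), of s]
        functional_linear(2)[OF fB, of u s]
      unfolding v_def by (auto simp: s_def abs_if split: if_splits)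
    have v1: "\<bar>v i\<bar> \<le> 1" "\<bar>lim v\<bar> \<le> 1" for i
      using conv_norm_ge(1,2)[OF v(1)] v(2) order_trans by blast+
    have v2: "(lim v)\<^sup>2 + (v 0)\<^sup>2 \<le> 1"
      by (rule order_trans[OF conv_norm_ge(3)[OF v(1)]])
        (use v(2) conv_norm_ge(4)[OF v(1)] in \<open>simp add: power_le_one\<close>)
    show ?thesis
    proof (cases "\<bar>T\<bar> / 4 < \<bar>v 0\<bar>")
      case True
      then have "(\<bar>T\<bar> / 4)\<^sup>2 \<le> \<bar>v 0\<bar>\<^sup>2" by (intro power_mono) auto
      then have "(lim v)\<^sup>2 \<le> 1 - T\<^sup>2 / 16" using v2 by (simp add: power_divide)
      also have "\<dots> \<le> \<kappa>\<^sup>2"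
        unfolding \<kappa>_def power2_diff by (simp add: power_divide)
      finally have "\<bar>lim v\<bar> \<le> \<bar>\<kappa>\<bar>" by (simp add: abs_le_square_iff)
      then show ?thesis using v T2 by (intro exI[of _ v]) (simp add: \<kappa>_def)
    next
      case False
      \<comment> \<open>With \<open>sqrt \<eta> = \<bar>T\<bar> / 2\<close> the gain \<open>\<bar>T\<bar> * (sqrt \<eta> - \<bar>v 0\<bar>)\<close> is at least \<open>T\<^sup>2 / 4\<close>, the loss at most
        \<open>\<eta>\<close>.\<close>
      define \<eta> where "\<eta> = T\<^sup>2 / 4"
      have \<eta>: "0 \<le> \<eta>" "\<eta> \<le> 1" using T2 by (simp_all add: \<eta>_def)
      define b where "b = T / 2 - (1 - \<eta>) * v 0"
      define w where "w i = (1 - \<eta>) * v i + b * ?e i" for i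
      have c1: "convergent (\<lambda>i. (1 - \<eta>) * v i)" "convergent (\<lambda>i. b * ?e i)"
        using v(1) convergent_indicators(1) by (auto intro!: convergent_mult convergent_const)
      have wc: "convergent w" unfolding w_def by (rule convergent_add[OF c1])
      have lw: "lim w = (1 - \<eta>) * lim v"
        unfolding w_def using lim_add[OF c1] lim_cmult[OF v(1), of "1 - \<eta>"]
          lim_cmult[OF convergent_indicators(1), of b 0] by (simp add: lim_indicators)
      have alw: "\<bar>lim w\<bar> \<le> 1 - \<eta>"
        unfolding lw abs_mult using \<eta> v1(2) by (simp add: mult_left_le)
      have w0: "w 0 = T / 2" by (simp add: w_def b_def)
      have "conv_norm w \<le> 1"
      proof (rule conv_norm_leI[OF wc])
        show "\<bar>w i\<bar> \<le> 1" if "0 < i" for i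
        proof -
          have "\<bar>w i\<bar> = (1 - \<eta>) * \<bar>v i\<bar>" using that \<eta> by (simp add: w_def abs_mult)
          also have "\<dots> \<le> 1 * 1" using \<eta> v1(1) by (intro mult_mono) auto
          finally show ?thesis by simp
        qed
        have "\<bar>lim w\<bar>\<^sup>2 \<le> (1 - \<eta>)\<^sup>2" using alw by (intro power_mono) auto
        also have "\<dots> \<le> (1 - \<eta>) * 1" unfolding power2_eq_square using \<eta> by (intro mult_left_mono) auto
        finally show "(lim w)\<^sup>2 + (w 0)\<^sup>2 \<le> 1\<^sup>2" by (simp add: w0 \<eta>_def power_divide)
      qed simp
      moreover have "\<bar>lim w\<bar> \<le> \<kappa>" using alw T2 unfolding \<kappa>_def \<eta>_def by linarith
      moreover have "1 - \<delta> < f w"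
      proof -
        have "f w = (1 - \<eta>) * f v + b * T"
          unfolding w_def using functional_linear[OF fB] v(1) c1 convergent_indicators(1) by (simp add: T_def)
        also have "\<dots> = f v - \<eta> * f v + T\<^sup>2 / 2 - (1 - \<eta>) * (v 0 * T)"
          by (simp add: b_def algebra_simps power2_eq_square)
        finally have fw: "f w = f v - \<eta> * f v + T\<^sup>2 / 2 - (1 - \<eta>) * (v 0 * T)" .
        have "\<eta> * f v \<le> \<eta> * 1" using fle[OF v(1)] v(2) \<eta> by (intro mult_left_mono) auto
        moreover have "(1 - \<eta>) * (v 0 * T) \<le> 1 * (\<bar>T\<bar> / 4 * \<bar>T\<bar>)"
        proof -
          have "\<bar>v 0 * T\<bar> \<le> \<bar>T\<bar> / 4 * \<bar>T\<bar>" unfolding abs_mult using False by (intro mult_right_mono) auto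
          moreover have "(1 - \<eta>) * (v 0 * T) \<le> (1 - \<eta>) * \<bar>v 0 * T\<bar>"
            using \<eta> by (intro mult_left_mono) auto
          moreover have "(1 - \<eta>) * \<bar>v 0 * T\<bar> \<le> 1 * \<bar>v 0 * T\<bar>"
            using \<eta> by (intro mult_right_mono) auto
          ultimately show ?thesis by linarith
        qed
        ultimately show ?thesis using v(3) unfolding fw by (simp add: \<eta>_def power2_eq_square)
      qed
      ultimately show ?thesis using wc by blast
    qed
  qed
  moreover have "\<kappa> < 1" using T2 by (simp add: \<kappa>_def)
  ultimately show ?thesis using namioka_point_conv_spaceI[OF fb] by blast
qed

text \<open>
  A functional on the sphere that vanishes on the extra coordinate is perturbed by a small multiple \<open>\<tau>\<close>
  of the coordinate functional \<open>p\<close> and then normalised by \<open>\<rho>\<close>, which differs from \<open>1\<close> by at most \<open>\<tau>\<close>.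
\<close>

lemma property_N_conv_space: "property_N conv_space"
  unfolding property_N_def
proof
  let ?D = "dual_space conv_space" and ?e = "indicator {0} :: nat \<Rightarrow> real"
  fix f assume f: "f \<in> unit_sphere ?D"
  then have fB: "f \<in> bounded_functionals conv_space" and nf: "nrm ?D f = 1"
    by (simp_all add: unit_sphere_def)
  have fle: "\<bar>f x\<bar> \<le> conv_norm x" if "convergent x" for x
    using conv_space.abs_le_dual_norm[OF fB] that nf by simp
  have "\<exists>g. namioka_point conv_space g \<and> g \<in> W" if W: "f \<in> W" "openin (weak_topology ?D) W" for W
  proof (cases "f ?e = 0")
    case False
    then show ?thesis using namioka_point_of_unit_sphere[OF f] W by blast
  next
    case True
    obtain \<epsilon> where \<epsilon>: "0 < \<epsilon>"
      "\<And>g. \<lbrakk>g \<in> bounded_functionals conv_space; nrm ?D (\<lambda>x. g x - f x) < \<epsilon>\<rbrakk> \<Longrightarrow> g \<in> W"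
      using weak_open_contains_dual_norm_ball[OF W(2,1) fB conv_space.dual_norm_nonneg] by blast
    define \<tau> where "\<tau> = min (1 / 2) (\<epsilon> / 8)"
    have \<tau>: "0 < \<tau>" "\<tau> \<le> 1 / 2" "4 * \<tau> < \<epsilon>" using \<epsilon>(1) by (auto simp: \<tau>_def)
    define p where "p x = (if convergent x then x 0 else 0 :: real)" for x
    have pB: "p \<in> bounded_functionals conv_space"
      unfolding bounded_functionals_def
      using convergent_add convergent_mult[OF convergent_const] conv_norm_ge(1)
      by (auto simp: p_def intro!: exI[of _ 1])
    define k where "k x = f x + \<tau> * p x" for x
    have kB: "k \<in> bounded_functionals conv_space"
      unfolding k_def by (intro bounded_functionals_add bounded_functionals_scale fB pB)
    have p1: "\<bar>\<tau> * p x\<bar> \<le> \<tau>" and f1: "\<bar>f x\<bar> \<le> 1" if "x \<in> closed_unit_ball conv_space" for x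
    proof -
      have x: "convergent x" "conv_norm x \<le> 1" using that by (simp_all add: closed_unit_ball_def)
      show "\<bar>f x\<bar> \<le> 1" using fle[OF x(1)] x(2) by simp
      have "\<bar>p x\<bar> \<le> 1" using conv_norm_ge(1)[OF x(1), of 0] x by (simp add: p_def)
      then show "\<bar>\<tau> * p x\<bar> \<le> \<tau>" unfolding abs_mult using \<tau>(1) by (simp add: mult_left_le)
    qed
    define \<rho> where "\<rho> = nrm ?D k"
    have k1: "\<bar>k x\<bar> \<le> \<rho>" if "x \<in> closed_unit_ball conv_space" for x
      unfolding \<rho>_def by (rule conv_space.abs_le_dual_norm_ball[OF kB that])
    have "\<bar>k x\<bar> \<le> 1 + \<tau>" if "x \<in> closed_unit_ball conv_space" for x
      using p1[OF that] f1[OF that] unfolding k_def by linarith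
    then have "\<rho> \<le> 1 + \<tau>"
      unfolding \<rho>_def by (rule conv_space.dual_norm_le)
    moreover have "\<bar>f x\<bar> \<le> \<rho> + \<tau>" if "x \<in> closed_unit_ball conv_space" for x
      using p1[OF that] k1[OF that] unfolding k_def by linarith
    then have "nrm ?D f \<le> \<rho> + \<tau>" by (rule conv_space.dual_norm_le)
    ultimately have \<rho>: "\<bar>1 - \<rho>\<bar> \<le> \<tau>" "1 / 2 \<le> \<rho>" using nf \<tau>(2) by auto
    define h where "h x = (1 / \<rho>) * k x" for x
    have hB: "h \<in> bounded_functionals conv_space"
      unfolding h_def by (intro bounded_functionals_scale kB)
    have "nrm ?D h \<le> 1"
      using k1 \<rho>(2) by (intro conv_space.dual_norm_le) (simp add: h_def)
    moreover have "\<rho> \<le> \<rho> * nrm ?D h"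
      unfolding \<rho>_def
    proof (rule conv_space.dual_norm_le, fold \<rho>_def)
      fix x assume x: "x \<in> closed_unit_ball conv_space"
      have "\<bar>h x\<bar> \<le> nrm ?D h" by (rule conv_space.abs_le_dual_norm_ball[OF hB x])
      then show "\<bar>k x\<bar> \<le> \<rho> * nrm ?D h" using \<rho>(2) by (simp add: h_def field_simps)
    qed
    ultimately have "nrm ?D h = 1" using \<rho>(2) by simp
    moreover have "h ?e = \<tau> / \<rho>"
      using True convergent_indicators(1)[of 0] by (simp add: h_def k_def p_def)
    ultimately have "namioka_point conv_space h"
      using \<tau>(1) \<rho>(2) hB by (intro namioka_point_of_unit_sphere) (auto simp: unit_sphere_def)
    moreover have "nrm ?D (\<lambda>x. h x - f x) \<le> 4 * \<tau>"
    proof (rule conv_space.dual_norm_le)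
      fix x assume x: "x \<in> closed_unit_ball conv_space"
      have "\<rho> * (h x - f x) = (1 - \<rho>) * f x + \<tau> * p x"
        using \<rho>(2) by (simp add: h_def k_def algebra_simps)
      moreover have "\<bar>(1 - \<rho>) * f x\<bar> \<le> \<tau> * 1"
        unfolding abs_mult using \<rho>(1) f1[OF x] by (intro mult_mono) auto
      ultimately have "\<bar>\<rho> * (h x - f x)\<bar> \<le> 2 * \<tau>" using p1[OF x] by linarith
      moreover have "1 / 2 * \<bar>h x - f x\<bar> \<le> \<bar>\<rho> * (h x - f x)\<bar>"
        unfolding abs_mult using \<rho>(2) by (intro mult_right_mono) auto
      ultimately show "\<bar>h x - f x\<bar> \<le> 4 * \<tau>" by simp
    qed
    then have "nrm ?D (\<lambda>x. h x - f x) < \<epsilon>" using \<tau>(3) by linarith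
    then have "h \<in> W" by (rule \<epsilon>(2)[OF hB])
    ultimately show ?thesis by blast
  qed
  then show "f \<in> weak_topology ?D closure_of {f. namioka_point conv_space f}"
    using fB unfolding in_closure_of conv_space.topspace_weak_dual by auto
qed

section \<open>Failure of Property (N) for the hyperplane\<close>

abbreviation hyper_space :: "(nat \<Rightarrow> real) normed_structure"
  where "hyper_space \<equiv> seq_space conv_hyperplane"

lemma conv_norm_hyperplane_le:
  assumes x: "x \<in> conv_hyperplane" and C: "\<And>i. \<bar>x i\<bar> \<le> C"
  shows "conv_norm x \<le> C"
proof (rule conv_norm_leI)
  have xc: "convergent x" and x0: "x 0 = 0" using x by (simp_all add: conv_hyperplane_def)
  show "convergent x" by fact
  show "0 \<le> C" using C[of 0] by simp
  have "(\<lambda>i. \<bar>x i\<bar>) \<longlonglongrightarrow> \<bar>lim x\<bar>" using xc by (intro tendsto_rabs) (simp add: convergent_LIMSEQ_iff)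
  then have "\<bar>lim x\<bar> \<le> C" using C by (intro Lim_bounded) auto
  then have "\<bar>lim x\<bar>\<^sup>2 \<le> C\<^sup>2" by (intro power_mono) auto
  then show "(lim x)\<^sup>2 + (x 0)\<^sup>2 \<le> C\<^sup>2" by (simp add: x0)
qed (rule C)

lemma tail_in_hyperplane: "indicator {n<..} \<in> conv_hyperplane"
  by (simp add: conv_hyperplane_def convergent_indicators)

lemma tail_in_ball: "indicator {n<..} \<in> closed_unit_ball hyper_space"
  using conv_norm_hyperplane_le[OF tail_in_hyperplane, of n 1] tail_in_hyperplane
  by (simp add: closed_unit_ball_def indicator_def)

definition mass_at_infinity :: "((nat \<Rightarrow> real) \<Rightarrow> real) \<Rightarrow> real"
  where "mass_at_infinity f = lim (\<lambda>n. f (indicator {n<..}))"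

text \<open>
  The values of \<open>f\<close> at the unit vectors are absolutely summable, as one sees by testing \<open>f\<close> on finite
  sequences of signs, and the values at the tails differ from a constant by partial sums of them.
\<close>

lemma LIMSEQ_mass_at_infinity:
  assumes f: "f \<in> bounded_functionals hyper_space"
  shows "(\<lambda>n. f (indicator {n<..})) \<longlonglongrightarrow> mass_at_infinity f"
proof -
  let ?e = "\<lambda>j. indicator {Suc j} :: nat \<Rightarrow> real"
  have e: "?e j \<in> conv_hyperplane" for j by (simp add: conv_hyperplane_def convergent_indicators)
  have "(\<Sum>j\<in>{..<n}. \<bar>f (?e j)\<bar>) \<le> nrm (dual_space hyper_space) f" for n
  proof -
    define c where "c j = sgn (f (?e j))" for j
    define x where "x i = (\<Sum>j\<in>{..<n}. c j * ?e j i)" for i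
    have x: "x \<in> conv_hyperplane" "f x = (\<Sum>j\<in>{..<n}. c j * f (?e j))"
      using functional_sum[OF convergent_subspace_hyperplane f, of "{..<n}" ?e c] e
      unfolding x_def by simp_all
    have "\<bar>x i\<bar> \<le> 1" for i
    proof (cases i)
      case 0
      then show ?thesis by (simp add: x_def)
    next
      case (Suc k)
      have "x i = (\<Sum>j\<in>{..<n}. if j = k then c j else 0)"
        unfolding x_def Suc by (intro sum.cong) (auto simp: indicator_def)
      then show ?thesis by (simp add: c_def abs_sgn_eq)
    qed
    then have "conv_norm x \<le> 1" by (rule conv_norm_hyperplane_le[OF x(1)])
    then have "\<bar>f x\<bar> \<le> nrm (dual_space hyper_space) f"
      using x(1) by (intro conv_hyperplane.abs_le_dual_norm_ball[OF f]) (simp add: closed_unit_ball_def)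
    moreover have "f x = (\<Sum>j\<in>{..<n}. \<bar>f (?e j)\<bar>)"
      unfolding x(2) c_def by (intro sum.cong refl) (simp add: abs_sgn mult.commute)
    ultimately show ?thesis by linarith
  qed
  then have "summable (\<lambda>j. \<bar>f (?e j)\<bar>)" by (intro summableI_nonneg_bounded) auto
  then have "summable (\<lambda>j. f (?e j))" by (rule summable_rabs_cancel)
  then have "convergent (\<lambda>n. f (indicator {0<..}) - (\<Sum>j<n. f (?e j)))"
    by (intro convergent_diff convergent_const) (simp add: summable_iff_convergent)
  moreover have "(\<lambda>n. f (indicator {n<..})) = (\<lambda>n. f (indicator {0<..}) - (\<Sum>j<n. f (?e j)))"
  proof
    fix n
    show "f (indicator {n<..}) = f (indicator {0<..}) - (\<Sum>j<n. f (?e j))"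
    proof (induction n)
      case (Suc n)
      have "indicator {n<..} = (\<lambda>i. indicator {Suc n<..} i + ?e n i)"
        by (auto simp: indicator_def fun_eq_iff)
      then have "f (indicator {n<..}) = f (indicator {Suc n<..}) + f (?e n)"
        using functional_linear(1)[OF f tail_in_hyperplane e, of "Suc n" n] by simp
      then show ?case using Suc by simp
    qed simp
  qed
  ultimately have "convergent (\<lambda>n. f (indicator {n<..}))" by (simp only:)
  then show ?thesis
    unfolding mass_at_infinity_def by (simp add: convergent_LIMSEQ_iff)
qed

lemma mass_at_infinity_bidual:
  "(\<lambda>f. if f \<in> bounded_functionals hyper_space then mass_at_infinity f else 0)
    \<in> carrier (dual_space (dual_space hyper_space))"
proof -
  let ?B = "bounded_functionals hyper_space"
  have "mass_at_infinity (\<lambda>x. f x + g x) = mass_at_infinity f + mass_at_infinity g"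
    if "f \<in> ?B" "g \<in> ?B" for f g
    unfolding mass_at_infinity_def[of "\<lambda>x. f x + g x"]
    by (intro limI tendsto_add LIMSEQ_mass_at_infinity that)
  moreover have "mass_at_infinity (\<lambda>x. c * f x) = c * mass_at_infinity f" if "f \<in> ?B" for c f
    unfolding mass_at_infinity_def[of "\<lambda>x. c * f x"]
    by (intro limI tendsto_mult_left LIMSEQ_mass_at_infinity that)
  moreover have "\<bar>mass_at_infinity f\<bar> \<le> 1 * nrm (dual_space hyper_space) f" if f: "f \<in> ?B" for f
  proof (rule Lim_bounded)
    show "(\<lambda>n. \<bar>f (indicator {n<..})\<bar>) \<longlonglongrightarrow> \<bar>mass_at_infinity f\<bar>"
      by (intro tendsto_rabs LIMSEQ_mass_at_infinity f)
    have "\<bar>f (indicator {n<..})\<bar> \<le> 1 * nrm (dual_space hyper_space) f" for n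
      using conv_hyperplane.abs_le_dual_norm_ball[OF f tail_in_ball] by simp
    then show "\<forall>n\<ge>0. \<bar>f (indicator {n<..})\<bar> \<le> 1 * nrm (dual_space hyper_space) f" by blast
  qed
  ultimately show ?thesis
    unfolding dual_space_sel(1) bounded_functionals_def[of "dual_space hyper_space"]
    by (auto simp: bounded_functionals_add bounded_functionals_scale intro: exI[of _ 1])
qed

lemma openin_mass_at_infinity:
  assumes "open U"
  shows "openin (weak_topology (dual_space hyper_space))
    {f \<in> bounded_functionals hyper_space. mass_at_infinity f \<in> U}"
proof -
  have "{f \<in> bounded_functionals hyper_space. mass_at_infinity f \<in> U} =
    {f \<in> carrier (dual_space hyper_space).
      (if f \<in> bounded_functionals hyper_space then mass_at_infinity f else 0) \<in> U}"
    by auto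
  then show ?thesis
    unfolding weak_topology_def
    using openin_initial_topology_preimage[OF mass_at_infinity_bidual assms] by simp
qed

definition lim_functional :: "(nat \<Rightarrow> real) \<Rightarrow> real"
  where "lim_functional x = (if x \<in> conv_hyperplane then lim x else 0)"

lemma hyperplane_closed:
  assumes "x \<in> conv_hyperplane" "y \<in> conv_hyperplane"
  shows "(\<lambda>i. x i + y i) \<in> conv_hyperplane" "(\<lambda>i. c * x i) \<in> conv_hyperplane"
  using convergent_subspace_hyperplane assms unfolding convergent_subspace_def by blast+

lemma lim_functional_bounded: "lim_functional \<in> bounded_functionals hyper_space"
proof -
  have "\<bar>lim x\<bar> \<le> 1 * conv_norm x" if "x \<in> conv_hyperplane" for x
    using conv_norm_ge(2) that by (simp add: conv_hyperplane_def)
  then show ?thesis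
    unfolding bounded_functionals_def
    by (auto simp: lim_functional_def hyperplane_closed intro!: exI[of _ 1])
      (auto simp: conv_hyperplane_def lim_add lim_cmult)
qed

definition coord_functional :: "nat \<Rightarrow> (nat \<Rightarrow> real) \<Rightarrow> real"
  where "coord_functional k x = (if x \<in> conv_hyperplane then x k else 0)"

lemma coord_functional_bounded: "coord_functional k \<in> bounded_functionals hyper_space"
proof -
  have "\<bar>x k\<bar> \<le> 1 * conv_norm x" if "x \<in> conv_hyperplane" for x
    using conv_norm_ge(1) that by (simp add: conv_hyperplane_def)
  then show ?thesis
    unfolding bounded_functionals_def
    by (auto simp: coord_functional_def hyperplane_closed intro!: exI[of _ 1])
qed

text \<open>
  Changing the tail of \<open>x\<close> beyond \<open>M\<close> by \<open>x (Suc k) - lim x\<close> gives a vector \<open>y M\<close> whose far entries are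
  close to \<open>x (Suc k)\<close>, so its norm is hardly larger than that of \<open>x\<close>. In the limit \<open>f\<close> takes on it
  the value of the modified functional at \<open>x\<close>.
\<close>

lemma shift_mass_in_ball:
  assumes f: "f \<in> closed_unit_ball (dual_space hyper_space)"
  shows "(\<lambda>x. f x + mass_at_infinity f * (coord_functional (Suc k) x - lim_functional x))
    \<in> closed_unit_ball (dual_space hyper_space)"
proof -
  let ?g = "\<lambda>x. f x + mass_at_infinity f * (coord_functional (Suc k) x - lim_functional x)"
  have fB: "f \<in> bounded_functionals hyper_space"
    and fle: "\<And>x. x \<in> conv_hyperplane \<Longrightarrow> \<bar>f x\<bar> \<le> conv_norm x"
    using f by (auto simp: conv_hyperplane.dual_ball_iff)
  have "\<bar>?g x\<bar> \<le> conv_norm x" if x: "x \<in> conv_hyperplane" for x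
  proof (rule field_le_epsilon)
    fix e :: real assume e: "0 < e"
    have xc: "convergent x" using x by (simp add: conv_hyperplane_def)
    define a where "a = x (Suc k) - lim x"
    define y where "y M i = x i + a * indicator {M<..} i" for M i
    have at: "(\<lambda>i. a * indicator {M<..} i) \<in> conv_hyperplane" for M
      by (rule hyperplane_closed(2)[OF tail_in_hyperplane tail_in_hyperplane])
    have y: "y M \<in> conv_hyperplane" for M
      unfolding y_def by (rule hyperplane_closed(1)[OF x at])
    have fy: "f (y M) = f x + a * f (indicator {M<..})" for M
      unfolding y_def using functional_linear(1)[OF fB x at] functional_linear(2)[OF fB tail_in_hyperplane]
      by simp
    have "x \<longlonglongrightarrow> lim x" using xc by (simp add: convergent_LIMSEQ_iff)
    then obtain K where K: "\<And>i. K \<le> i \<Longrightarrow> \<bar>x i - lim x\<bar> < e"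
      using e by (metis LIMSEQ_iff real_norm_def)
    have "\<bar>f (y M)\<bar> \<le> conv_norm x + e" if M: "K \<le> M" for M
    proof (rule order_trans[OF fle[OF y] conv_norm_hyperplane_le[OF y]])
      fix i
      show "\<bar>y M i\<bar> \<le> conv_norm x + e"
      proof (cases "M < i")
        case True
        then have "y M i = x (Suc k) + (x i - lim x)" by (simp add: y_def a_def)
        moreover have "\<bar>x i - lim x\<bar> < e" using K True M by simp
        ultimately show ?thesis using conv_norm_ge(1)[OF xc, of "Suc k"] by linarith
      next
        case False
        then show ?thesis using conv_norm_ge(1)[OF xc, of i] e by (simp add: y_def)
      qed
    qed
    moreover have "(\<lambda>M. \<bar>f (y M)\<bar>) \<longlonglongrightarrow> \<bar>f x + a * mass_at_infinity f\<bar>"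
      unfolding fy by (intro tendsto_rabs tendsto_add tendsto_const tendsto_mult_left LIMSEQ_mass_at_infinity fB)
    ultimately have "\<bar>f x + a * mass_at_infinity f\<bar> \<le> conv_norm x + e"
      by (intro Lim_bounded[where M = K]) auto
    then show "\<bar>?g x\<bar> \<le> conv_norm x + e"
      using x by (simp add: a_def coord_functional_def lim_functional_def mult.commute)
  qed
  moreover have "?g \<in> bounded_functionals hyper_space"
    by (intro bounded_functionals_add bounded_functionals_scale bounded_functionals_diff fB
        coord_functional_bounded lim_functional_bounded)
  ultimately show ?thesis by (simp add: conv_hyperplane.dual_ball_iff)
qed

lemma mass_at_infinity_shift:
  assumes f: "f \<in> bounded_functionals hyper_space"
  shows "mass_at_infinity (\<lambda>x. f x + mass_at_infinity f * (coord_functional (Suc k) x - lim_functional x)) = 0"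
proof -
  let ?d = "\<lambda>n. coord_functional (Suc k) (indicator {n<..}) - lim_functional (indicator {n<..})"
  have "?d \<longlonglongrightarrow> -1"
    by (rule tendsto_eventually)
      (auto simp: eventually_sequentially coord_functional_def lim_functional_def tail_in_hyperplane
        lim_indicators intro!: exI[of _ "Suc k"])
  then have "(\<lambda>n. f (indicator {n<..}) + mass_at_infinity f * ?d n) \<longlonglongrightarrow>
      mass_at_infinity f + mass_at_infinity f * -1"
    by (intro tendsto_add tendsto_mult_left LIMSEQ_mass_at_infinity f)
  then show ?thesis
    unfolding mass_at_infinity_def[of "\<lambda>x. f x + _ x"] by (intro limI) simp
qed

lemma mass_at_infinity_namioka_point:
  assumes f: "namioka_point hyper_space f"
  shows "mass_at_infinity f = 0"
proof (rule ccontr)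
  assume nz: "mass_at_infinity f \<noteq> 0"
  define g where "g k x = f x + mass_at_infinity f * (coord_functional (Suc k) x - lim_functional x)" for k x
  have fb: "f \<in> closed_unit_ball (dual_space hyper_space)"
    using f by (simp add: namioka_point_def)
  then have fB: "f \<in> bounded_functionals hyper_space" by (simp add: conv_hyperplane.dual_ball_iff)
  let ?W = "{h \<in> bounded_functionals hyper_space. mass_at_infinity h \<in> - {0}}"
  have "eventually (\<lambda>k. g k \<in> ?W) sequentially"
  proof (rule conv_hyperplane.namioka_point_weak_limit[OF f])
    show "g k \<in> closed_unit_ball (dual_space hyper_space)" for k
      unfolding g_def by (rule shift_mass_in_ball[OF fb])
    show "openin (weak_topology (dual_space hyper_space)) ?W"
      by (rule openin_mass_at_infinity) (simp add: open_Compl)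
    show "f \<in> ?W" using fB nz by simp
    fix x assume "x \<in> carrier hyper_space"
    then have x: "x \<in> conv_hyperplane" by simp
    have "(\<lambda>k. x (Suc k)) \<longlonglongrightarrow> lim x"
      using x by (intro LIMSEQ_Suc) (simp add: conv_hyperplane_def convergent_LIMSEQ_iff)
    then have "(\<lambda>k. f x + mass_at_infinity f * (x (Suc k) - lim x)) \<longlonglongrightarrow>
        f x + mass_at_infinity f * (lim x - lim x)"
      by (intro tendsto_intros)
    then show "(\<lambda>k. g k x) \<longlonglongrightarrow> f x"
      using x by (simp add: g_def coord_functional_def lim_functional_def)
  qed
  moreover have "mass_at_infinity (g k) = 0" for k
    unfolding g_def by (rule mass_at_infinity_shift[OF fB])
  ultimately show False by simp
qed

text \<open>
  The set of functionals with nonzero mass at infinity is weakly open, contains the limit functional and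
  misses all Namioka points.
\<close>

lemma not_property_N_hyper_space: "\<not> property_N hyper_space"
proof
  let ?D = "dual_space hyper_space"
  assume N: "property_N hyper_space"
  have l1: "\<bar>lim_functional x\<bar> \<le> conv_norm x" if "x \<in> conv_hyperplane" for x
    using that conv_norm_ge(2) by (simp add: lim_functional_def conv_hyperplane_def)
  have "lim_functional \<in> closed_unit_ball ?D"
    using l1 lim_functional_bounded by (simp add: conv_hyperplane.dual_ball_iff)
  moreover have ltail: "lim_functional (indicator {n<..}) = 1" for n
    by (simp add: lim_functional_def tail_in_hyperplane lim_indicators)
  have "1 \<le> nrm ?D lim_functional"
    using conv_hyperplane.abs_le_dual_norm_ball[OF lim_functional_bounded tail_in_ball]
    by (simp add: ltail)
  ultimately have "lim_functional \<in> unit_sphere ?D"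
    by (simp add: unit_sphere_def closed_unit_ball_def)
  with N have cl: "lim_functional \<in> weak_topology ?D closure_of {f. namioka_point hyper_space f}"
    unfolding property_N_def by blast
  have "mass_at_infinity lim_functional = 1"
    unfolding mass_at_infinity_def by (intro limI) (simp add: ltail)
  moreover define W where "W = {f \<in> bounded_functionals hyper_space. mass_at_infinity f \<in> - {0}}"
  ultimately have "lim_functional \<in> W" using lim_functional_bounded by simp
  moreover have "openin (weak_topology ?D) W"
    unfolding W_def by (rule openin_mass_at_infinity) (simp add: open_Compl)
  ultimately obtain f where "f \<in> {f. namioka_point hyper_space f}" "f \<in> W"
    using cl unfolding in_closure_of by meson
  then show False using mass_at_infinity_namioka_point by (simp add: W_def)
qed

theorem proposition5p1:
  shows "\<exists>(Z :: (nat \<Rightarrow> real) normed_structure) Y.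
    real_banach_space Z \<and> property_N Z \<and>
    closed_subspace Y Z \<and> \<not> property_N (Z\<lparr>carrier := Y\<rparr>)"
proof (intro exI conjI)
  show "real_banach_space conv_space" by (rule real_banach_space_conv_space)
  show "property_N conv_space" by (rule property_N_conv_space)
  show "closed_subspace conv_hyperplane conv_space" by (rule closed_subspace_conv_hyperplane)
  show "\<not> property_N (conv_space\<lparr>carrier := conv_hyperplane\<rparr>)"
    using not_property_N_hyper_space by simp
qed

end
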